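(* Let $X$ be a finite-dimensional Banach space and let $E$ be a direction set in $X$. Then the map $\phi'_E:(\mathcal{R}'(E),d_H)\to(\mathcal{N}'(E),d)$, $\phi'_E(\overline{\alpha})=\overline{\rho(\cdot;\alpha E)}$, is an isometry. Moreover, if $\mathcal{F}$ is a complete, symmetric, simplicial $E$-fan, then the map $\phi'_{\mathcal{F}}:(\mathcal{R}'(\mathcal{F}),d_H)\to(\mathcal{N}'(\mathcal{F}),d)$, $\phi'_{\mathcal{F}}(\overline{\alpha})=\overline{\rho(\cdot;\alpha E)}$, is an isometry.
   Context: $\mathcal{N}(X)$ is the set of equivalent norms on $X$, and $B_p=\{x: p(x)\le1\}$. A direction set in $(X,\|\cdot\|)$ is a finite subset $E\subset S_X$ of the unit sphere with $E=-E$ and $\operatorname{conv}(E)$ having nonempty interior; choosing one representative from each antipodal pair, write $E=\{\pm x_1,\dots,\pm x_n\}$ (cardinality $2n$). $\operatorname{Dir}(E)=\{cx:c>0,x\in E\}$; $\operatorname{Ext}$ denotes the set of extreme points. For $\alpha=(\alpha_1,\dots,\alpha_n)\in\mathbb{R}^n_{>0}$, $\operatorname{conv}(\alpha E)=\operatorname{conv}\{\pm\alpha_1^{-1}x_1,\dots,\pm\alpha_n^{-1}x_n\}$ and $\rho(x;\alpha E)=\inf\{r>0:x\in r\operatorname{conv}(\alpha E)\}$. The multiindex $\alpha$ is $E$-admissible if for every $i$ and every $0<\varepsilon_i<\alpha_i$, with $\alpha'=(\alpha_1,\dots,\alpha_i-\varepsilon_i,\dots,\alpha_n)$, one has $\rho(\cdot;\alpha'E)\ne\rho(\cdot;\alpha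 E)$. A fan $\mathcal{F}$ in $X$ is a finite collection of polyhedral cones, closed under taking faces, such that the intersection of any two of its cones is a face of both. It is simplicial if every cone is generated by a linearly independent set, complete if its cones cover $X$, symmetric if $-C\in\mathcal{F}$ whenever $C\in\mathcal{F}$, and an $E$-fan if every cone of $\mathcal{F}$ is generated by rays determined by elements of $E$. For a complete, symmetric, simplicial $E$-fan $\mathcal{F}$ and a symmetric weight $\alpha:E\to(0,\infty)$ (i.e. $\alpha(-x)=\alpha(x)$), the pair $(\mathcal{F},\alpha)$ is $E$-admissible if for every maximal cone $C=\operatorname{cone}(x_{n_1},\dots,x_{n_d})\in\mathcal{F}$ ($d=\dim X$, generators in $E$) the unique $\ell_C^\alpha\in X^*$ with $\ell_C^\alpha(x_{n_k})=\alpha(x_{n_k})$ for all $k$ satisfies $\ell_C^\alpha(x_i)\le\alpha(x_i)$ for every $x_i\in E$. Symmetric weights on $E$ are identified with multiindices via $\alpha\leftrightarrow(\alpha(x_1),\dots,\alpha(x_n))\in\mathbb{R}^n_{>0}$. Models: $\mathcal{N}(E)=\{p\in\mathcal{N}(X):\operatorname{Ext}(B_p)\subset\operatorname{Dir}(E)\}$; $\mathcal{R}(E)=\{\alpha\in\mathbb{R}^n_{>0}:\alpha\text{ is }E\text{-admissible}\}$; $\mathcal{N}(\mathcal{F})=\{p\in\mathcal{N}(X): p\text{ is linear on every cone }C\in\mathcal{F}\}$; $\mathcal{R}(\mathcal{F})$ is the set of symmetric weights $\alpha:E\to(0,\infty)$ with $(\mathcal{F},\alpha)$ $E$-admissible.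 A prime denotes the quotient by the relation $x\sim y\iff y=cx$ for some $c>0$, and a bar denotes the class of an element. Metrics: for $p,q\in\mathcal{N}(X)$, $d(\overline p,\overline q)=\log(u/l)$, where $u\ge l>0$ are the optimal constants with $l\,p\le q\le u\,p$ on $X$. On $\mathbb{R}^n_{>0}/\sim$ the Hilbert metric is $d_H(\overline\alpha,\overline\beta)=\log\big(\max_i\frac{\alpha_i}{\beta_i}\big/\min_i\frac{\alpha_i}{\beta_i}\big)$.
   Formalization: The fan part fails if some x∈E spans no ray of F: increasing α(x) changes the class of α but not ρ(·;αE). It is proved for R'(F) when every element of E spans a ray of F, and for every complete, symmetric, simplicial E-fan with R(F) replaced by R(F)∩R(E). *)

theory Defs
  imports "HOL-Analysis.Analysis"
begin

section \<open>Equivalent norms\<close>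

definition equivalent_norm :: "('a::real_normed_vector \<Rightarrow> real) \<Rightarrow> bool" where
  "equivalent_norm p \<longleftrightarrow>
     (\<forall>v. 0 \<le> p v) \<and> (\<forall>v. p v = 0 \<longleftrightarrow> v = 0) \<and>
     (\<forall>c v. p (c *\<^sub>R v) = \<bar>c\<bar> * p v) \<and>
     (\<forall>v w. p (v + w) \<le> p v + p w) \<and>
     (\<exists>a>0. \<exists>b>0. \<forall>v. a * norm v \<le> p v \<and> p v \<le> b * norm v)"

definition norm_ball :: "('a \<Rightarrow> real) \<Rightarrow> 'a set" where
  "norm_ball p = {v. p v \<le> 1}"

definition optimal_upper :: "('a \<Rightarrow> real) \<Rightarrow> ('a \<Rightarrow> real) \<Rightarrow> real" where
  "optimal_upper p q = Inf {u. 0 < u \<and> (\<forall>v. q v \<le> u * p v)}"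

definition optimal_lower :: "('a \<Rightarrow> real) \<Rightarrow> ('a \<Rightarrow> real) \<Rightarrow> real" where
  "optimal_lower p q = Sup {l. 0 < l \<and> (\<forall>v. l * p v \<le> q v)}"

definition norm_dist :: "('a \<Rightarrow> real) \<Rightarrow> ('a \<Rightarrow> real) \<Rightarrow> real" where
  "norm_dist p q = ln (optimal_upper p q / optimal_lower p q)"


section \<open>Direction sets\<close>

definition direction_set :: "'a::real_normed_vector set \<Rightarrow> bool" where
  "direction_set E \<longleftrightarrow>
     finite E \<and> E \<subseteq> sphere 0 1 \<and> uminus ` E = E \<and> interior (convex hull E) \<noteq> {}"

text \<open>The family \<open>x\<close> picks one representative from each antipodal pair of \<open>E\<close>; the number \<open>n\<close>
  of pairs is the cardinality of the index type, so multiindices are elements of \<open>real ^ 'n\<close>.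
  A direction set is never empty, so such an index type always exists.\<close>

definition antipodal_reps :: "'a::real_normed_vector set \<Rightarrow> ('n::finite \<Rightarrow> 'a) \<Rightarrow> bool" where
  "antipodal_reps E x \<longleftrightarrow> E = range x \<union> uminus ` range x \<and> card E = 2 * CARD('n)"

definition directions :: "'a::real_vector set \<Rightarrow> 'a set" where
  "directions E = {c *\<^sub>R y | c y. 0 < c \<and> y \<in> E}"

definition scaled_hull :: "('n::finite \<Rightarrow> 'a::real_vector) \<Rightarrow> real ^ 'n \<Rightarrow> 'a set" where
  "scaled_hull x \<alpha> =
     convex hull (range (\<lambda>i. inverse (\<alpha> $ i) *\<^sub>R x i) \<union> range (\<lambda>i. - (inverse (\<alpha> $ i) *\<^sub>R x i)))"

definition rho :: "('n::finite \<Rightarrow> 'a::real_vector) \<Rightarrow> real ^ 'n \<Rightarrow> 'a \<Rightarrow> real" where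
  "rho x \<alpha> v = Inf {r. 0 < r \<and> v \<in> (\<lambda>w. r *\<^sub>R w) ` scaled_hull x \<alpha>}"

definition admissible_multiindex :: "('n::finite \<Rightarrow> 'a::real_vector) \<Rightarrow> real ^ 'n \<Rightarrow> bool" where
  "admissible_multiindex x \<alpha> \<longleftrightarrow>
     (\<forall>i \<epsilon>. 0 < \<epsilon> \<and> \<epsilon> < \<alpha> $ i \<longrightarrow>
        rho x (\<chi> j. if j = i then \<alpha> $ j - \<epsilon> else \<alpha> $ j) \<noteq> rho x \<alpha>)"

definition R_dir :: "('n::finite \<Rightarrow> 'a::real_vector) \<Rightarrow> (real ^ 'n) set" where
  "R_dir x = {\<alpha>. (\<forall>i. 0 < \<alpha> $ i) \<and> admissible_multiindex x \<alpha>}"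

definition N_dir :: "'a::real_normed_vector set \<Rightarrow> ('a \<Rightarrow> real) set" where
  "N_dir E = {p. equivalent_norm p \<and> {v. v extreme_point_of norm_ball p} \<subseteq> directions E}"


section \<open>Fans\<close>

definition polyhedral_cone :: "'a::real_vector set \<Rightarrow> bool" where
  "polyhedral_cone C \<longleftrightarrow> (\<exists>S. finite S \<and> C = convex_cone hull S)"

text \<open>The library's \<open>face_of\<close> counts the empty set as a face; it is not a cone and is excluded.\<close>

definition fan :: "'a::real_vector set set \<Rightarrow> bool" where
  "fan F \<longleftrightarrow>
     finite F \<and> (\<forall>C\<in>F. polyhedral_cone C) \<and>
     (\<forall>C\<in>F. \<forall>D. D face_of C \<and> D \<noteq> {} \<longrightarrow> D \<in> F) \<and>
     (\<forall>C\<in>F. \<forall>D\<in>F. (C \<inter> D) face_of C \<and> (C \<inter> D) face_of D)"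

definition simplicial_fan :: "'a::real_vector set set \<Rightarrow> bool" where
  "simplicial_fan F \<longleftrightarrow>
     fan F \<and> (\<forall>C\<in>F. \<exists>S. finite S \<and> independent S \<and> C = convex_cone hull S)"

definition complete_fan :: "'a::real_vector set set \<Rightarrow> bool" where
  "complete_fan F \<longleftrightarrow> fan F \<and> \<Union> F = UNIV"

definition symmetric_fan :: "'a::real_vector set set \<Rightarrow> bool" where
  "symmetric_fan F \<longleftrightarrow> fan F \<and> (\<forall>C\<in>F. uminus ` C \<in> F)"

definition E_fan :: "'a::real_vector set \<Rightarrow> 'a set set \<Rightarrow> bool" where
  "E_fan E F \<longleftrightarrow> fan F \<and> (\<forall>C\<in>F. \<exists>S\<subseteq>E. C = convex_cone hull S)"

definition maximal_cone :: "'a set set \<Rightarrow> 'a set \<Rightarrow> bool" where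
  "maximal_cone F C \<longleftrightarrow> C \<in> F \<and> (\<forall>D\<in>F. \<not> C \<subset> D)"

definition symmetric_weight :: "'a::real_vector set \<Rightarrow> ('a \<Rightarrow> real) \<Rightarrow> bool" where
  "symmetric_weight E w \<longleftrightarrow> (\<forall>y\<in>E. 0 < w y \<and> w (- y) = w y)"

text \<open>\<open>S\<close> is the basis \<open>{x\<^bsub>n\<^sub>1\<^esub>, \<dots>, x\<^bsub>n\<^sub>d\<^esub>}\<close> of generators of the maximal cone \<open>C\<close>, and \<open>l\<close> is
  the functional it determines; for a basis \<open>S\<close> exactly one \<open>l\<close> satisfies the premise.\<close>

definition admissible_fan_weight ::
    "'a::real_normed_vector set \<Rightarrow> 'a set set \<Rightarrow> ('a \<Rightarrow> real) \<Rightarrow> bool" where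
  "admissible_fan_weight E F w \<longleftrightarrow>
     (\<forall>C S l. maximal_cone F C \<and>
        S \<subseteq> E \<and> independent S \<and> card S = dim (UNIV :: 'a set) \<and> C = convex_cone hull S \<and>
        bounded_linear l \<and> (\<forall>y\<in>S. l y = w y)
        \<longrightarrow> (\<forall>y\<in>E. l y \<le> w y))"

text \<open>Symmetric weights are identified with multiindices via \<open>w \<mapsto> (w (x\<^sub>1), \<dots>, w (x\<^sub>n))\<close>.\<close>

definition R_fan ::
    "('n::finite \<Rightarrow> 'a::real_normed_vector) \<Rightarrow> 'a set \<Rightarrow> 'a set set \<Rightarrow> (real ^ 'n) set" where
  "R_fan x E F =
     (\<lambda>w. \<chi> i. w (x i)) ` {w. symmetric_weight E w \<and> admissible_fan_weight E F w}"

definition N_fan :: "'a::real_normed_vector set set \<Rightarrow> ('a \<Rightarrow> real) set" where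
  "N_fan F = {p. equivalent_norm p \<and> (\<forall>C\<in>F. \<exists>l. bounded_linear l \<and> (\<forall>v\<in>C. p v = l v))}"


section \<open>Quotients by positive scaling\<close>

definition scaling_rel :: "(real \<Rightarrow> 'b \<Rightarrow> 'b) \<Rightarrow> 'b set \<Rightarrow> ('b \<times> 'b) set" where
  "scaling_rel sc A = {(y, z). y \<in> A \<and> z \<in> A \<and> (\<exists>c>0. z = sc c y)}"

definition scale_fun :: "real \<Rightarrow> ('a \<Rightarrow> real) \<Rightarrow> 'a \<Rightarrow> real" where
  "scale_fun c p = (\<lambda>v. c * p v)"

definition index_class :: "(real ^ 'n::finite) set \<Rightarrow> real ^ 'n \<Rightarrow> (real ^ 'n) set" where
  "index_class R \<alpha> = scaling_rel scaleR R `` {\<alpha>}"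

definition index_quotient :: "(real ^ 'n::finite) set \<Rightarrow> (real ^ 'n) set set" where
  "index_quotient R = R // scaling_rel scaleR R"

definition norm_class :: "('a \<Rightarrow> real) set \<Rightarrow> ('a \<Rightarrow> real) \<Rightarrow> ('a \<Rightarrow> real) set" where
  "norm_class N p = scaling_rel scale_fun N `` {p}"

definition norm_quotient :: "('a \<Rightarrow> real) set \<Rightarrow> ('a \<Rightarrow> real) set set" where
  "norm_quotient N = N // scaling_rel scale_fun N"

definition hilbert_dist :: "real ^ 'n::finite \<Rightarrow> real ^ 'n \<Rightarrow> real" where
  "hilbert_dist \<alpha> \<beta> =
     ln (Max (range (\<lambda>i. \<alpha> $ i / \<beta> $ i)) / Min (range (\<lambda>i. \<alpha> $ i / \<beta> $ i)))"

text \<open>Both distances are invariant under positive scaling of either argument, so the common value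
  over all representatives exists.\<close>

definition class_dist :: "('b \<Rightarrow> 'b \<Rightarrow> real) \<Rightarrow> 'b set \<Rightarrow> 'b set \<Rightarrow> real" where
  "class_dist d A B = (THE r. \<forall>a\<in>A. \<forall>b\<in>B. d a b = r)"

definition phi' ::
    "('n::finite \<Rightarrow> 'a::real_vector) \<Rightarrow> ('a \<Rightarrow> real) set \<Rightarrow> (real ^ 'n) set \<Rightarrow> ('a \<Rightarrow> real) set" where
  "phi' x N K = (THE L. \<forall>\<alpha>\<in>K. L = norm_class N (rho x \<alpha>))"

definition isometry_onto ::
    "'b set \<Rightarrow> ('b \<Rightarrow> 'b \<Rightarrow> real) \<Rightarrow> 'c set \<Rightarrow> ('c \<Rightarrow> 'c \<Rightarrow> real) \<Rightarrow> ('b \<Rightarrow> 'c) \<Rightarrow> bool" where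
  "isometry_onto A dA B dB f \<longleftrightarrow>
     bij_betw f A B \<and> (\<forall>a\<in>A. \<forall>b\<in>A. dB (f a) (f b) = dA a b)"

text \<open>The first conjunct says that \<open>\<alpha> \<mapsto> rho x \<alpha>\<close> maps \<open>R\<close> into \<open>N\<close> and that \<open>phi'\<close> is the map it
  induces between the quotients.\<close>

definition phi_isometry ::
    "('n::finite \<Rightarrow> 'a::real_normed_vector) \<Rightarrow> (real ^ 'n) set \<Rightarrow> ('a \<Rightarrow> real) set \<Rightarrow> bool" where
  "phi_isometry x R N \<longleftrightarrow>
     (\<forall>\<alpha>\<in>R. rho x \<alpha> \<in> N \<and> phi' x N (index_class R \<alpha>) = norm_class N (rho x \<alpha>)) \<and>
     isometry_onto (index_quotient R) (class_dist hilbert_dist)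
                   (norm_quotient N) (class_dist norm_dist) (phi' x N)"

text \<open>For an \<open>E\<close>-fan the rays of \<open>F\<close> may form a proper subset of the rays spanned by \<open>E\<close>. If
  \<open>y \<in> E\<close> spans no ray of \<open>F\<close>, admissibility of \<open>(F, w)\<close> bounds \<open>w y\<close> only from below, so
  increasing it changes the multiindex in \<open>R_fan x E F\<close> without changing its gauge. This
  predicate excludes that.\<close>

definition all_rays :: "'a::real_vector set \<Rightarrow> 'a set set \<Rightarrow> bool" where
  "all_rays E F \<longleftrightarrow> (\<forall>y\<in>E. convex_cone hull {y} \<in> F)"

end

theory Submission
  imports Defs
begin

text \<open>
  Everything rests on one extremal property of the gauge \<open>rho x \<alpha>\<close>: it is the largest seminorm
  \<open>p\<close> with \<open>p (x i) \<le> \<alpha> $ i\<close> for all \<open>i\<close> (lemmas \<open>le_rho\<close> and \<open>rho_generator_le\<close>).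
  Hence lowering \<open>\<alpha> $ i\<close> leaves the gauge unchanged as long as \<open>\<alpha> $ i\<close> stays at or above
  \<open>rho x \<alpha> (x i)\<close>, and \<open>\<alpha>\<close> is admissible exactly if \<open>rho x \<alpha> (x i) = \<alpha> $ i\<close> for all \<open>i\<close>
  (\<open>admissible_iff\<close>). So on admissible multiindices the map \<open>\<alpha> \<mapsto> rho x \<alpha>\<close> is inverted by
  evaluating a norm at the directions.

  The same extremal property turns \<open>rho x \<beta> \<le> u * rho x \<alpha>\<close>, an inequality on the whole space,
  into the finitely many inequalities \<open>\<beta> $ i \<le> u * \<alpha> $ i\<close> (\<open>rho_le_mult_iff\<close>). The optimal
  constants between two gauges are therefore the maximum and the minimum of \<open>\<beta> $ i / \<alpha> $ i\<close>, and
  the two distances agree. What remains, packaged in \<open>phi_isometryI\<close>, is to identify which norms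
  are gauges of multiindices from the given set.

  If the extreme points of the unit ball of \<open>p\<close> lie in the given directions, Krein--Milman makes
  the ball the hull of the points \<open>x i / p (x i)\<close> and their negatives, so \<open>p\<close> is the gauge of its
  own values. The Krein--Milman theorem for Euclidean spaces is transported along a linear embedding
  into \<open>real ^ 'n\<close>.

  If \<open>p\<close> is linear on the cones of a complete fan, writing a vector in the generators of its cone
  shows again that \<open>p\<close> is the gauge of its values, and these values are admissible for the fan
  because a sublinear function dominates each functional with which it agrees on a cone having
  interior. Conversely, let \<open>w\<close> be an admissible weight and \<open>l\<close> its functional on a maximal cone.
  Maximality of the gauge gives \<open>l \<le> rho\<close>, subadditivity gives \<open>rho \<le> l\<close> on the cone, so the
  gauge is linear there. This reaches every cone of the fan since each is contained in a maximal
  cone generated by a basis of the space taken from \<open>E\<close>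
  (\<open>cone_below_maximal_simplicial_cone\<close>).
\<close>


section \<open>Cones\<close>

lemma convex_cone_sum:
  assumes "convex_cone T" "finite S" "\<And>s. s \<in> S \<Longrightarrow> f s \<in> T"
  shows "sum f S \<in> T"
  using assms(2,3)
  by (induction S rule: finite_induct) (simp_all add: assms(1) convex_cone_contains_0 convex_cone_add)

lemma convex_cone_hull_finite:
  fixes S :: "'a::real_vector set"
  assumes "finite S"
  shows "convex_cone hull S = {v. \<exists>c. (\<forall>s\<in>S. 0 \<le> c s) \<and> v = (\<Sum>s\<in>S. c s *\<^sub>R s)}"
proof (rule hull_unique)
  show "S \<subseteq> {v. \<exists>c. (\<forall>s\<in>S. 0 \<le> c s) \<and> v = (\<Sum>s\<in>S. c s *\<^sub>R s)}"
  proof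
    fix s assume s: "s \<in> S"
    have "(\<Sum>t\<in>S. (if t = s then 1 else 0) *\<^sub>R t) = (\<Sum>t\<in>S. if t = s then t else 0)"
      by (intro sum.cong) auto
    also have "\<dots> = s" using assms s by simp
    finally show "s \<in> {v. \<exists>c. (\<forall>s\<in>S. 0 \<le> c s) \<and> v = (\<Sum>s\<in>S. c s *\<^sub>R s)}"
      by (intro CollectI exI[of _ "\<lambda>t. if t = s then 1 else 0"]) auto
  qed
next
  have add: "\<exists>e. (\<forall>s\<in>S. 0 \<le> e s) \<and> (\<Sum>s\<in>S. c s *\<^sub>R s) + (\<Sum>s\<in>S. d s *\<^sub>R s) = (\<Sum>s\<in>S. e s *\<^sub>R s)"
    if "\<forall>s\<in>S. 0 \<le> c s" "\<forall>s\<in>S. 0 \<le> d s" for c d :: "'a \<Rightarrow> real"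
    using that by (intro exI[of _ "\<lambda>s. c s + d s"]) (simp add: sum.distrib scaleR_add_left)
  have scale: "\<exists>e. (\<forall>s\<in>S. 0 \<le> e s) \<and> r *\<^sub>R (\<Sum>s\<in>S. c s *\<^sub>R s) = (\<Sum>s\<in>S. e s *\<^sub>R s)"
    if "\<forall>s\<in>S. 0 \<le> c s" "0 \<le> r" for c :: "'a \<Rightarrow> real" and r
    using that by (intro exI[of _ "\<lambda>s. r * c s"]) (simp add: scaleR_sum_right)
  have zero: "\<exists>c. (\<forall>s\<in>S. 0 \<le> c s) \<and> 0 = (\<Sum>s\<in>S. c s *\<^sub>R s)"
    by (intro exI[of _ "\<lambda>_. 0"]) simp
  show "convex_cone {v. \<exists>c. (\<forall>s\<in>S. 0 \<le> c s) \<and> v = (\<Sum>s\<in>S. c s *\<^sub>R s)}"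
    unfolding convex_cone_iff using zero by (auto intro: add scale)
next
  fix T assume "S \<subseteq> T" "convex_cone T"
  then show "{v. \<exists>c. (\<forall>s\<in>S. 0 \<le> c s) \<and> v = (\<Sum>s\<in>S. c s *\<^sub>R s)} \<subseteq> T"
    using assms by (auto intro!: convex_cone_sum convex_cone_scaleR)
qed

lemma convex_cone_hull_subset_span: "convex_cone hull S \<subseteq> span S"
  by (intro hull_minimal span_superset convex_cone_span)

lemma span_convex_cone_hull: "span (convex_cone hull S) = span S"
proof
  show "span (convex_cone hull S) \<subseteq> span S"
    by (intro span_minimal convex_cone_hull_subset_span subspace_span)
  show "span S \<subseteq> span (convex_cone hull S)"
    by (intro span_mono hull_subset)
qed

lemma linear_eq_on_convex_cone_hull:
  assumes "linear f" "linear g" "\<And>s. s \<in> S \<Longrightarrow> f s = g s" "v \<in> convex_cone hull S"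
  shows "f v = g v"
  using linear_eq_on_span[OF assms(1,2,3)] assms(4) convex_cone_hull_subset_span by blast

text \<open>The sum \<open>a + b\<close> is the midpoint of \<open>2 *\<^sub>R a\<close> and \<open>2 *\<^sub>R b\<close>, so a face containing it contains these
two points as well.\<close>

lemma convex_cone_face_summand:
  assumes T: "T face_of C" "convex_cone T" and ab: "a \<in> C" "b \<in> C" "a + b \<in> T" and C: "convex_cone C"
  shows "a \<in> T"
proof -
  have "2 *\<^sub>R a \<in> T"
  proof (cases "a = b")
    case True
    then show ?thesis using ab by (simp add: scaleR_2)
  next
    case False
    have "a + b \<in> open_segment (2 *\<^sub>R a) (2 *\<^sub>R b)"
      unfolding in_segment using False by (auto intro!: exI[of _ "1/2"])
    then show ?thesis
      using face_ofD[OF T(1), of "a + b" "2 *\<^sub>R a" "2 *\<^sub>R b"] ab C convex_cone_scaleR by force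
  qed
  then have "(1/2) *\<^sub>R (2 *\<^sub>R a) \<in> T"
    by (rule convex_cone_scaleR[OF T(2), rotated]) simp
  then show ?thesis by simp
qed

text \<open>Expand \<open>t\<close> as a nonnegative combination of \<open>S\<close> and take coordinates with respect to \<open>T\<close>. These
coordinates are nonnegative on \<open>S\<close>, so no cancellation is possible: every \<open>s\<close> that occurs with a
positive coefficient has all its coordinates other than the one at \<open>t\<close> equal to zero.\<close>

lemma exists_extreme_ray_generator:
  fixes T S :: "'a::real_vector set"
  assumes T: "finite T" "independent T" and S: "finite S" "S \<subseteq> convex_cone hull T"
    and t: "t \<in> T" "t \<in> convex_cone hull S"
  shows "\<exists>s\<in>S. \<exists>k>0. s = k *\<^sub>R t"
proof -
  have rep_sum: "representation T (\<Sum>u\<in>T. c u *\<^sub>R u) u = c u" if "u \<in> T" for c u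
    using representation_sum[OF T(2), of T "\<lambda>u. c u *\<^sub>R u"] that T
    by (simp add: representation_scale representation_basis span_base span_scale
        if_distrib[of "\<lambda>r. _ * r"] sum.delta' cong: if_cong)
  have S_span: "S \<subseteq> span T"
    using S(2) convex_cone_hull_subset_span by (rule subset_trans)
  have S_nonneg: "0 \<le> representation T s u" if s: "s \<in> S" and u: "u \<in> T" for s u
  proof -
    have "s \<in> convex_cone hull T" using S(2) s by blast
    then show ?thesis
      unfolding convex_cone_hull_finite[OF T(1)] using rep_sum u by auto
  qed
  obtain c where c: "\<And>s. s \<in> S \<Longrightarrow> 0 \<le> c s" "t = (\<Sum>s\<in>S. c s *\<^sub>R s)"
    using t(2) unfolding convex_cone_hull_finite[OF S(1)] by auto
  have coord: "(if u = t then 1 else 0) = (\<Sum>s\<in>S. c s * representation T s u)" for u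
  proof -
    have "representation T t u = (\<Sum>s\<in>S. representation T (c s *\<^sub>R s) u)"
      unfolding c(2) using S_span by (subst representation_sum[OF T(2)]) (auto intro: span_scale)
    also have "\<dots> = (\<Sum>s\<in>S. c s * representation T s u)"
      using S_span T(2) by (intro sum.cong) (auto simp: representation_scale)
    finally show ?thesis
      using t(1) T(2) by (simp add: representation_basis eq_commute)
  qed
  have "(\<Sum>s\<in>S. c s * representation T s t) \<noteq> 0"
    using coord[of t] by simp
  then obtain s where s: "s \<in> S" "c s * representation T s t \<noteq> 0"
    by (rule sum.not_neutral_contains_not_neutral)
  have pos: "0 < c s" "0 < representation T s t"
    using s c(1)[OF s(1)] S_nonneg[OF s(1) t(1)] by auto
  have other: "representation T s u = 0" if "u \<in> T" "u \<noteq> t" for u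
  proof -
    have sum0: "(\<Sum>r\<in>S. c r * representation T r u) = 0" using coord[of u] that by simp
    have "c s * representation T s u = 0"
      by (rule sum_nonneg_0[OF S(1) _ sum0 s(1)]) (simp add: c(1) S_nonneg that(1))
    then show ?thesis using pos by simp
  qed
  have "s = (\<Sum>u\<in>T. representation T s u *\<^sub>R u)"
    using sum_representation_eq[OF T(2), of s T] S_span s(1) T(1) by auto
  also have "\<dots> = (\<Sum>u\<in>T. if u = t then representation T s t *\<^sub>R t else 0)"
    using other by (intro sum.cong) auto
  also have "\<dots> = representation T s t *\<^sub>R t"
    using T(1) t(1) by simp
  finally show ?thesis using s(1) pos(2) by blast
qed

text \<open>The definitions of a simplicial fan and of an \<open>E\<close>-fan provide separate sets of generators for a
cone, one independent and one contained in \<open>E\<close>. This lemma produces a set with both properties,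
by choosing an element of \<open>S\<close> on each ray spanned by \<open>T\<close>.\<close>

lemma independent_generators_subset:
  fixes T S :: "'a::real_vector set"
  assumes T: "finite T" "independent T" and S: "finite S"
    and eq: "convex_cone hull T = convex_cone hull S"
  obtains B where "B \<subseteq> S" "independent B" "convex_cone hull B = convex_cone hull S"
proof -
  have "\<exists>s\<in>S. \<exists>k>0. s = k *\<^sub>R t" if "t \<in> T" for t
  proof (rule exists_extreme_ray_generator[OF T S])
    show "S \<subseteq> convex_cone hull T" unfolding eq by (rule hull_subset)
    show "t \<in> convex_cone hull S" unfolding eq[symmetric] by (rule hull_inc[OF that])
  qed (rule that)
  then obtain g where g: "\<And>t. t \<in> T \<Longrightarrow> g t \<in> S" "\<And>t. t \<in> T \<Longrightarrow> \<exists>k>0. g t = k *\<^sub>R t"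
    by metis
  have t_mult: "\<exists>k\<ge>0. t = k *\<^sub>R g t" if t: "t \<in> T" for t
  proof -
    obtain k where "k > 0" "g t = k *\<^sub>R t" using g(2)[OF t] by blast
    then show ?thesis by (intro exI[of _ "inverse k"]) auto
  qed
  have T_hull: "T \<subseteq> convex_cone hull (g ` T)"
  proof
    fix t assume t: "t \<in> T"
    obtain k where k: "0 \<le> k" "t = k *\<^sub>R g t" using t_mult[OF t] by blast
    have "g t \<in> convex_cone hull (g ` T)" using t by (intro hull_inc imageI)
    then have "k *\<^sub>R g t \<in> convex_cone hull (g ` T)" using k(1) by (rule convex_cone_hull_mul)
    then show "t \<in> convex_cone hull (g ` T)" using k(2) by metis
  qed
  have hull: "convex_cone hull (g ` T) = convex_cone hull S"
  proof
    show "convex_cone hull (g ` T) \<subseteq> convex_cone hull S"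
      using g(1) by (intro hull_mono) auto
    show "convex_cone hull S \<subseteq> convex_cone hull (g ` T)"
      unfolding eq[symmetric] using T_hull convex_cone_convex_cone_hull by (rule hull_minimal)
  qed
  (* A maximal independent subset of the chosen generators has at least card T elements, so it is
     everything and the chosen generators are independent. *)
  obtain B where B: "B \<subseteq> g ` T" "independent B" "g ` T \<subseteq> span B"
    by (rule maximal_independent_subset[of "g ` T"])
  have fin: "finite B" using B(1) T(1) finite_subset by blast
  have "T \<subseteq> span B"
    using T_hull subset_trans[OF convex_cone_hull_subset_span span_minimal[OF B(3) subspace_span]]
    by (rule subset_trans)
  then have "card T \<le> card B"
    using independent_span_bound[OF fin T(2)] by blast
  then have "card (g ` T) \<le> card B"
    using card_image_le[OF T(1), of g] by linarith
  then have "B = g ` T"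
    using B(1) T(1) by (meson card_seteq finite_imageI)
  then show thesis
    using that[of B] B(2) hull g(1) by auto
qed


section \<open>Complete simplicial fans\<close>

text \<open>Given a point \<open>w\<close> outside the first subspaces but inside a new one \<open>V\<close>, move it in a direction
\<open>u \<notin> V\<close>: the line \<open>w + t *\<^sub>R u\<close> leaves \<open>V\<close> at once and meets each earlier subspace at
most once, so all but finitely many \<open>t\<close> work.\<close>

lemma exists_outside_proper_subspaces:
  fixes \<V> :: "'a::real_vector set set"
  assumes "finite \<V>" "\<And>V. V \<in> \<V> \<Longrightarrow> subspace V \<and> V \<noteq> UNIV"
  shows "\<exists>w. \<forall>V\<in>\<V>. w \<notin> V"
  using assms
proof (induction \<V> rule: finite_induct)
  case empty
  then show ?case by blast
next
  case (insert V \<V>)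
  then obtain w where w: "\<forall>U\<in>\<V>. w \<notin> U" by auto
  show ?case
  proof (cases "w \<in> V")
    case False
    then show ?thesis using w by auto
  next
    case True
    obtain u where u: "u \<notin> V" using insert.prems by blast
    have unique: "t = t'" if U: "U \<in> \<V>" "w + t *\<^sub>R u \<in> U" "w + t' *\<^sub>R u \<in> U" for U t t'
    proof (rule ccontr)
      assume ne: "t \<noteq> t'"
      have sub: "subspace U" using insert.prems U by blast
      have "(w + t *\<^sub>R u) - (w + t' *\<^sub>R u) \<in> U" using U sub subspace_diff by blast
      then have "(t - t') *\<^sub>R u \<in> U" by (simp add: algebra_simps)
      then have "u \<in> U" using sub ne subspace_scale[OF sub, of "(t - t') *\<^sub>R u" "inverse (t - t')"] by simp
      then have "w \<in> U"
        using U(2) sub subspace_diff[OF sub U(2), of "t *\<^sub>R u"] subspace_scale[OF sub] by simp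
      then show False using w U by blast
    qed
    have "finite {t. w + t *\<^sub>R u \<in> U}" if "U \<in> \<V>" for U
    proof (cases "\<exists>t. w + t *\<^sub>R u \<in> U")
      case True
      then obtain t where "w + t *\<^sub>R u \<in> U" by blast
      then have "{t. w + t *\<^sub>R u \<in> U} \<subseteq> {t}" using unique[OF that] by blast
      then show ?thesis using finite_subset by blast
    qed auto
    then have "finite (insert 0 (\<Union>U\<in>\<V>. {t. w + t *\<^sub>R u \<in> U}))"
      using insert.hyps(1) by blast
    then obtain t where t: "t \<notin> insert 0 (\<Union>U\<in>\<V>. {t. w + t *\<^sub>R u \<in> U})"
      using infinite_UNIV_char_0[where 'a=real] ex_new_if_finite by blast
    have "w + t *\<^sub>R u \<notin> V"
    proof
      assume a: "w + t *\<^sub>R u \<in> V"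
      have sub: "subspace V" using insert.prems by blast
      have "t *\<^sub>R u \<in> V" using subspace_diff[OF sub a True] by simp
      then have "u \<in> V" using t subspace_scale[OF sub, of "t *\<^sub>R u" "inverse t"] by simp
      then show False using u by blast
    qed
    then show ?thesis using t by blast
  qed
qed

text \<open>A cone generated by a basis is cut out by the inequalities saying that the coordinates are
nonnegative, and these pass to the limit along a line.\<close>

lemma simplicial_cone_limit:
  fixes S :: "'a::real_vector set"
  assumes S: "finite S" "independent S" "span S = UNIV"
    and freq: "\<exists>\<^sub>F t in at_right (0::real). z + t *\<^sub>R w \<in> convex_cone hull S"
  shows "z \<in> convex_cone hull S"
proof -
  have nonneg: "0 \<le> representation S z s" if s: "s \<in> S" for s
  proof (rule ccontr)
    assume neg: "\<not> 0 \<le> representation S z s"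
    have "((\<lambda>t. representation S z s + t * representation S w s) \<longlongrightarrow>
        representation S z s + 0 * representation S w s) (at_right 0)"
      by (intro tendsto_intros)
    then have "\<forall>\<^sub>F t in at_right 0. representation S z s + t * representation S w s < 0"
      using neg by (intro order_tendstoD(2)) auto
    with freq have "\<exists>\<^sub>F t in at_right (0::real). z + t *\<^sub>R w \<in> convex_cone hull S \<and>
        representation S z s + t * representation S w s < 0"
      by (rule frequently_eventually_frequently)
    then obtain t where t: "z + t *\<^sub>R w \<in> convex_cone hull S"
      "representation S z s + t * representation S w s < 0"
      using frequently_ex by blast
    obtain c where c: "\<And>s. s \<in> S \<Longrightarrow> 0 \<le> c s" "z + t *\<^sub>R w = (\<Sum>s\<in>S. c s *\<^sub>R s)"
      using t(1) unfolding convex_cone_hull_finite[OF S(1)] by auto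
    have "representation S (z + t *\<^sub>R w) s = (\<Sum>u\<in>S. representation S (c u *\<^sub>R u) s)"
      unfolding c(2) using S by (subst representation_sum) auto
    also have "\<dots> = c s"
      using S s by (simp add: representation_scale representation_basis
          if_distrib[of "\<lambda>r. _ * r"] sum.delta' cong: if_cong)
    finally have "0 \<le> representation S (z + t *\<^sub>R w) s" using c(1) s by simp
    then show False
      using t(2) S by (simp add: representation_add representation_scale)
  qed
  have "z = (\<Sum>s\<in>S. representation S z s *\<^sub>R s)"
    using sum_representation_eq[OF S(2), of z S] S by auto
  then show ?thesis
    unfolding convex_cone_hull_finite[OF S(1)] using nonneg by blast
qed

lemma polyhedral_convex_cone: "polyhedral_cone C \<Longrightarrow> convex_cone C"
  unfolding polyhedral_cone_def using convex_cone_convex_cone_hull by blast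

text \<open>Choose \<open>w\<close> outside the spans of all cones that are not full-dimensional. One of the finitely many
cones contains \<open>z + t *\<^sub>R w\<close> for arbitrarily small \<open>t > 0\<close>. Two such points have a multiple of
\<open>w\<close> as difference, so this cone is full-dimensional, and it contains the limit \<open>z\<close>.\<close>

lemma full_dimensional_cone_at:
  fixes F :: "'a::real_vector set set"
  assumes F: "complete_fan F" "simplicial_fan F"
  shows "\<exists>D\<in>F. z \<in> D \<and> span D = UNIV"
proof -
  have fin: "finite F" using F(1) unfolding complete_fan_def fan_def by blast
  have "\<exists>w. \<forall>V\<in>span ` {D\<in>F. span D \<noteq> UNIV}. w \<notin> V"
    using fin by (intro exists_outside_proper_subspaces) (simp, blast intro: subspace_span)
  then obtain w where w: "\<And>D. D \<in> F \<Longrightarrow> w \<in> span D \<Longrightarrow> span D = UNIV"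
    by (simp, metis)
  have cover: "\<exists>D\<in>F. z + t *\<^sub>R w \<in> D" for t :: real
    using F(1) unfolding complete_fan_def by blast
  have "\<exists>\<^sub>F t in at_right (0::real). \<exists>D\<in>F. z + t *\<^sub>R w \<in> D"
    using cover by (intro eventually_frequently always_eventually) simp_all
  from frequently_bex_finite[OF fin this]
  obtain D where D: "D \<in> F" "\<exists>\<^sub>F t in at_right (0::real). z + t *\<^sub>R w \<in> D"
    by blast
  from frequently_ex[OF frequently_eventually_frequently[OF D(2) eventually_at_right_less]]
  obtain t where t: "z + t *\<^sub>R w \<in> D" "t > 0" by blast
  have "\<forall>\<^sub>F r in at_right 0. r < t" using t(2) by (intro eventually_at_rightI[of 0 t]) auto
  from frequently_ex[OF frequently_eventually_frequently[OF D(2) this]]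
  obtain r where r: "z + r *\<^sub>R w \<in> D" "r < t" by blast
  have "(z + t *\<^sub>R w) - (z + r *\<^sub>R w) \<in> span D"
    using t r by (intro span_diff span_base)
  then have "(t - r) *\<^sub>R w \<in> span D" by (simp add: algebra_simps)
  then have "inverse (t - r) *\<^sub>R (t - r) *\<^sub>R w \<in> span D" by (rule span_scale)
  then have full: "span D = UNIV" using w D(1) r(2) by simp
  obtain S where S: "finite S" "independent S" "D = convex_cone hull S"
    using F(2) D(1) unfolding simplicial_fan_def by blast
  have "span S = UNIV" using full S(3) span_convex_cone_hull by metis
  then have "z \<in> D" using simplicial_cone_limit[OF S(1,2)] D(2) S(3) by blast
  then show ?thesis using D(1) full by blast
qed

text \<open>Apply \<open>full_dimensional_cone_at\<close> to the sum of the generators of \<open>C\<close>, a relative interior point. A face of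
\<open>C\<close> that contains this point is all of \<open>C\<close>, so the full-dimensional cone found there contains
\<open>C\<close>; any cone of the fan that is maximal above it is full-dimensional too.\<close>

lemma cone_below_maximal_simplicial_cone:
  fixes F :: "'a::real_vector set set"
  assumes F: "complete_fan F" "simplicial_fan F" "E_fan E F" and E: "finite E" and C: "C \<in> F"
  obtains S where "S \<subseteq> E" "independent S" "span S = UNIV" "card S = dim (UNIV :: 'a set)"
    "maximal_cone F (convex_cone hull S)" "C \<subseteq> convex_cone hull S"
proof -
  have fan: "fan F" using F(1) unfolding complete_fan_def by blast
  have cc: "\<And>D. D \<in> F \<Longrightarrow> convex_cone D"
    using fan polyhedral_convex_cone unfolding fan_def by blast
  obtain T where T: "finite T" "C = convex_cone hull T"
    using F(2) C unfolding simplicial_fan_def by blast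
  obtain D where D: "D \<in> F" "\<Sum>T \<in> D" "span D = UNIV"
    using full_dimensional_cone_at[OF F(1,2)] by blast
  have CD: "(C \<inter> D) face_of C" using fan C D(1) unfolding fan_def by blast
  have ccCD: "convex_cone (C \<inter> D)"
    using cc[OF C] cc[OF D(1)] by (simp add: convex_cone_iff)
  have "T \<subseteq> C \<inter> D"
  proof
    fix t assume t: "t \<in> T"
    have TC: "T \<subseteq> C" using T(2) hull_subset by metis
    have "\<Sum>(T - {t}) \<in> C"
      using T(1) TC by (intro convex_cone_sum[OF cc[OF C]]) auto
    moreover have "t + \<Sum>(T - {t}) = \<Sum>T" using T(1) t by (simp add: sum.remove)
    moreover have "\<Sum>T \<in> C"
      using T(1) TC by (intro convex_cone_sum[OF cc[OF C]]) auto
    ultimately show "t \<in> C \<inter> D"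
      using convex_cone_face_summand[OF CD ccCD, of t "\<Sum>(T - {t})"] t TC D(2) cc[OF C] by auto
  qed
  then have sub: "C \<subseteq> D" using T(2) hull_minimal ccCD by (metis le_inf_iff)
  have "finite F" using fan unfolding fan_def by blast
  then obtain M where M: "M \<in> F" "D \<subseteq> M" "\<forall>B\<in>F. M \<subseteq> B \<longrightarrow> M = B"
    using finite_has_maximal2[of F D] D(1) by auto
  then have maxM: "maximal_cone F M" unfolding maximal_cone_def by blast
  obtain U where U: "finite U" "independent U" "M = convex_cone hull U"
    using F(2) M(1) unfolding simplicial_fan_def by blast
  obtain S0 where S0: "S0 \<subseteq> E" "M = convex_cone hull S0"
    using F(3) M(1) unfolding E_fan_def by blast
  have finS0: "finite S0" using S0 E finite_subset by blast
  have hull_eq: "convex_cone hull U = convex_cone hull S0" using U S0 by simp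
  obtain S where S: "S \<subseteq> S0" "independent S" "convex_cone hull S = convex_cone hull S0"
    by (rule independent_generators_subset[OF U(1,2) finS0 hull_eq])
  have "span M = UNIV" using D(3) M(2) span_mono by blast
  then have full: "span S = UNIV" using S(3) S0(2) span_convex_cone_hull by metis
  have card: "card S = dim (UNIV :: 'a set)"
    using dim_eq_card[of S UNIV] S(2) full by simp
  show thesis
  proof (rule that[OF _ S(2) full card])
    show "S \<subseteq> E" using S(1) S0(1) by (rule subset_trans)
    show "maximal_cone F (convex_cone hull S)" using maxM S(3) S0(2) by metis
    show "C \<subseteq> convex_cone hull S" using sub M(2) unfolding S(3) S0(2)[symmetric] by (rule subset_trans)
  qed
qed

lemma span_eq_UNIV_of_card_eq_dim:
  fixes S B :: "'a::real_vector set"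
  assumes B: "finite B" "span B = UNIV" and S: "independent S" "card S = dim (UNIV :: 'a set)"
  shows "span S = UNIV"
proof -
  obtain A where A: "S \<subseteq> A" "A \<subseteq> UNIV" "independent A" "UNIV \<subseteq> span A"
    by (rule maximal_independent_subset_extend[OF subset_UNIV S(1)])
  then have span_A: "span A = UNIV" by blast
  have "finite A" using independent_span_bound[OF B(1) A(3)] B(2) by simp
  moreover have "card A = card S" using dim_eq_card[of A UNIV] A(3) span_A S(2) by simp
  ultimately have "S = A" using A(1) by (metis card_subset_eq)
  then show ?thesis using span_A by simp
qed


section \<open>The gauge of a scaled direction hull\<close>

lemma mem_scaleR_image_iff:
  fixes v :: "'b::real_vector"
  assumes "0 < r" shows "v \<in> (\<lambda>w. r *\<^sub>R w) ` K \<longleftrightarrow> inverse r *\<^sub>R v \<in> K"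
proof
  assume "inverse r *\<^sub>R v \<in> K"
  then have "r *\<^sub>R inverse r *\<^sub>R v \<in> (\<lambda>w. r *\<^sub>R w) ` K" by (rule imageI)
  then show "v \<in> (\<lambda>w. r *\<^sub>R w) ` K" using assms by simp
qed (use assms in auto)

lemma equivalent_normD:
  assumes "equivalent_norm p"
  shows "0 \<le> p v" "p v = 0 \<longleftrightarrow> v = 0" "p (c *\<^sub>R v) = \<bar>c\<bar> * p v" "p (v + w) \<le> p v + p w"
  using assms unfolding equivalent_norm_def by auto

lemma convex_norm_ball:
  assumes p: "equivalent_norm p"
  shows "convex (norm_ball p)"
proof (rule convexI)
  fix v w and s t :: real
  assume vw: "v \<in> norm_ball p" "w \<in> norm_ball p" and st: "0 \<le> s" "0 \<le> t" "s + t = 1"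
  have "s * p v \<le> s * 1" "t * p w \<le> t * 1"
    using vw st unfolding norm_ball_def by (intro mult_left_mono; simp)+
  then show "s *\<^sub>R v + t *\<^sub>R w \<in> norm_ball p"
    using equivalent_normD(4)[OF p, of "s *\<^sub>R v" "t *\<^sub>R w"] st
    unfolding norm_ball_def by (simp add: equivalent_normD(3)[OF p])
qed

locale direction_family =
  fixes E :: "'a::real_normed_vector set" and x :: "'n::finite \<Rightarrow> 'a"
  assumes dirset: "direction_set E" and reps: "antipodal_reps E x"
begin

lemma E_eq: "E = range x \<union> uminus ` range x"
  using reps unfolding antipodal_reps_def by blast

lemma x_in_E: "x i \<in> E"
  using E_eq by blast

lemma norm_E: "y \<in> E \<Longrightarrow> norm y = 1"
  using dirset unfolding direction_set_def by (auto simp: subset_iff)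

lemma finite_E: "finite E"
  using dirset unfolding direction_set_def by blast

lemma E_cases:
  assumes "y \<in> E" obtains i where "y = x i" | i where "y = - x i"
  using assms unfolding E_eq by blast

text \<open>Averaging a ball inside the symmetric convex set with the reflection of its centre moves the ball to
the origin.\<close>

lemma ball_in_hull: obtains e where "0 < e" "ball 0 e \<subseteq> convex hull E"
proof -
  obtain z where "z \<in> interior (convex hull E)"
    using dirset unfolding direction_set_def by blast
  then obtain e where e: "0 < e" "ball z e \<subseteq> convex hull E"
    using mem_interior by blast
  have sym: "uminus ` (convex hull E) = convex hull E"
    using convex_hull_linear_image[of uminus E] dirset
    unfolding direction_set_def by (simp add: linear_uminus)
  have z: "- z \<in> convex hull E"
    using e sym by (metis centre_in_ball imageI subsetD)
  have "ball 0 (e/2) \<subseteq> convex hull E"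
  proof
    fix v :: 'a assume "v \<in> ball 0 (e/2)"
    then have "z + 2 *\<^sub>R v \<in> ball z e" by (simp add: dist_norm)
    then have "(1/2) *\<^sub>R (z + 2 *\<^sub>R v) + (1/2) *\<^sub>R (- z) \<in> convex hull E"
      using e z by (intro convexD[OF convex_convex_hull]) auto
    then show "v \<in> convex hull E" by (simp add: algebra_simps)
  qed
  then show thesis using that[of "e/2"] e(1) by simp
qed

lemma span_E: "span E = UNIV"
proof -
  obtain e where e: "0 < e" "ball 0 e \<subseteq> convex hull E" by (rule ball_in_hull)
  have "v \<in> span E" for v
  proof (cases "v = 0")
    case True
    then show ?thesis by (simp add: span_zero)
  next
    case False
    define t where "t = e / (2 * norm v)"
    have t: "t > 0" "t * norm v < e" using False e(1) unfolding t_def by auto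
    then have "t *\<^sub>R v \<in> ball 0 e" by (simp add: dist_norm)
    then have "t *\<^sub>R v \<in> span E"
      using e(2) convex_hull_subset_span by blast
    then have "inverse t *\<^sub>R t *\<^sub>R v \<in> span E" by (rule span_scale)
    then show ?thesis using t(1) by simp
  qed
  then show ?thesis by blast
qed

text \<open>A linear map is bounded on the finite set \<open>E\<close>, hence on its convex hull, which contains a ball.\<close>

lemma linear_imp_bounded_linear:
  fixes l :: "'a \<Rightarrow> 'b::real_normed_vector"
  assumes l: "linear l"
  shows "bounded_linear l"
proof -
  obtain e where e: "0 < e" "ball 0 e \<subseteq> convex hull E" by (rule ball_in_hull)
  define M where "M = (\<Sum>y\<in>E. norm (l y))"
  have ME: "norm (l y) \<le> M" if "y \<in> E" for y
    unfolding M_def using finite_E that by (intro member_le_sum) auto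
  have "convex (l -` cball 0 M)"
    using l by (intro convex_linear_vimage) auto
  then have hull: "convex hull E \<subseteq> l -` cball 0 M"
    using ME by (intro hull_minimal) auto
  have "norm (l v) \<le> norm v * (2 * M / e)" for v
  proof (cases "v = 0")
    case True
    then show ?thesis using linear_0[OF l] by simp
  next
    case False
    define t where "t = e / (2 * norm v)"
    have t: "t > 0" "t * norm v < e" using False e(1) unfolding t_def by auto
    then have "t *\<^sub>R v \<in> ball 0 e" by (simp add: dist_norm)
    then have "t *\<^sub>R v \<in> l -` cball 0 M" using e(2) hull by blast
    then have "norm (l (t *\<^sub>R v)) \<le> M" by simp
    then have "t * norm (l v) \<le> M" using t(1) by (simp add: linear_scale[OF l])
    then show ?thesis using False e(1) unfolding t_def by (simp add: field_simps)
  qed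
  then show ?thesis
    by (intro bounded_linear_intro[of l "2 * M / e"]) (auto simp: linear_add[OF l] linear_scale[OF l])
qed

lemma scaled_point_in_hull: "inverse (\<alpha> $ i) *\<^sub>R x i \<in> scaled_hull x \<alpha>"
  "- (inverse (\<alpha> $ i) *\<^sub>R x i) \<in> scaled_hull x \<alpha>"
  unfolding scaled_hull_def by (auto intro!: hull_inc)

lemma convex_scaled_hull: "convex (scaled_hull x \<alpha>)"
  unfolding scaled_hull_def by (rule convex_convex_hull)

lemma uminus_in_scaled_hull:
  assumes "v \<in> scaled_hull x \<alpha>" shows "- v \<in> scaled_hull x \<alpha>"
proof -
  let ?P = "range (\<lambda>i. inverse (\<alpha> $ i) *\<^sub>R x i) \<union> range (\<lambda>i. - (inverse (\<alpha> $ i) *\<^sub>R x i))"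
  have "uminus ` ?P = ?P" by (auto simp: image_image image_Un)
  then have "uminus ` scaled_hull x \<alpha> = scaled_hull x \<alpha>"
    unfolding scaled_hull_def using convex_hull_linear_image[of uminus ?P]
    by (simp add: linear_uminus)
  then show ?thesis using assms by blast
qed

lemma zero_in_scaled_hull: "0 \<in> scaled_hull x \<alpha>"
proof -
  have "(1/2) *\<^sub>R v + (1/2) *\<^sub>R (- v) \<in> scaled_hull x \<alpha>" if "v \<in> scaled_hull x \<alpha>" for v
    using that uminus_in_scaled_hull by (intro convexD[OF convex_scaled_hull]) auto
  then show ?thesis using scaled_point_in_hull(1) by force
qed

lemma compact_scaled_hull: "compact (scaled_hull x \<alpha>)"
  unfolding scaled_hull_def by (intro finite_imp_compact_convex_hull) auto

lemma scaled_hull_subset: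
  assumes "convex K" "\<And>i. inverse (\<alpha> $ i) *\<^sub>R x i \<in> K" "\<And>v. v \<in> K \<Longrightarrow> - v \<in> K"
  shows "scaled_hull x \<alpha> \<subseteq> K"
  unfolding scaled_hull_def using assms by (intro hull_minimal) auto

lemma scaleR_in_scaled_hull:
  assumes "v \<in> scaled_hull x \<alpha>" "0 \<le> t" "t \<le> 1"
  shows "t *\<^sub>R v \<in> scaled_hull x \<alpha>"
  using convexD[OF convex_scaled_hull assms(1) zero_in_scaled_hull, of t "1 - t"] assms(2,3) by simp

lemma rho_altdef: "rho x \<alpha> v = Inf {r. 0 < r \<and> inverse r *\<^sub>R v \<in> scaled_hull x \<alpha>}"
  unfolding rho_def by (intro arg_cong[of _ _ Inf]) (auto simp: mem_scaleR_image_iff)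

lemma rho_le:
  assumes "0 < r" "inverse r *\<^sub>R v \<in> scaled_hull x \<alpha>" shows "rho x \<alpha> v \<le> r"
  unfolding rho_altdef using assms by (intro cInf_lower bdd_belowI[of _ 0]) auto

text \<open>With \<open>M\<close> at least every \<open>\<alpha> $ i\<close>, the scaled hull contains \<open>inverse M\<close> times the hull of
\<open>E\<close>.\<close>

lemma absorbing_scaled_hull:
  assumes pos: "\<And>i. 0 < \<alpha> $ i"
  obtains e where "0 < e" "\<And>v. norm v < e \<Longrightarrow> v \<in> scaled_hull x \<alpha>"
proof -
  obtain e where e: "0 < e" "ball 0 e \<subseteq> convex hull E" by (rule ball_in_hull)
  define M where "M = (\<Sum>i\<in>UNIV. \<alpha> $ i)"
  have M: "\<alpha> $ i \<le> M" for i unfolding M_def using pos by (intro member_le_sum) (auto intro: less_imp_le)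
  have M0: "0 < M" using pos[of undefined] M[of undefined] by linarith
  have "inverse M *\<^sub>R x i \<in> scaled_hull x \<alpha>" for i
    using scaleR_in_scaled_hull[OF scaled_point_in_hull(1)[of \<alpha> i], of "\<alpha> $ i / M"] pos[of i] M[of i] M0
    by (simp add: field_simps)
  then have "y \<in> (\<lambda>y. inverse M *\<^sub>R y) -` scaled_hull x \<alpha>" if "y \<in> E" for y
    using that uminus_in_scaled_hull by (elim E_cases) fastforce+
  then have "E \<subseteq> (\<lambda>y. inverse M *\<^sub>R y) -` scaled_hull x \<alpha>" by blast
  then have sub: "convex hull E \<subseteq> (\<lambda>y. inverse M *\<^sub>R y) -` scaled_hull x \<alpha>"
    by (intro hull_minimal convex_linear_vimage convex_scaled_hull linear_scale_self)
  have "v \<in> scaled_hull x \<alpha>" if v: "norm v < e / M" for v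
  proof -
    have "M *\<^sub>R v \<in> ball 0 e" using v M0 by (simp add: field_simps)
    then have "inverse M *\<^sub>R M *\<^sub>R v \<in> scaled_hull x \<alpha>" using e(2) sub by blast
    then show ?thesis using M0 by simp
  qed
  then show thesis using that[of "e / M"] e(1) M0 by simp
qed

lemma rho_ge:
  assumes pos: "\<And>i. 0 < \<alpha> $ i"
    and b: "\<And>r. 0 < r \<Longrightarrow> inverse r *\<^sub>R v \<in> scaled_hull x \<alpha> \<Longrightarrow> b \<le> r"
  shows "b \<le> rho x \<alpha> v"
proof -
  obtain e where e: "0 < e" "\<And>v. norm v < e \<Longrightarrow> v \<in> scaled_hull x \<alpha>"
    using absorbing_scaled_hull[of \<alpha>] pos by blast
  define r where "r = norm v / e + 1"
  have "r > 0" unfolding r_def using e(1) by (simp add: add_nonneg_pos)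
  moreover have "norm (inverse r *\<^sub>R v) < e"
    using \<open>r > 0\<close> e(1) unfolding r_def by (simp add: field_simps)
  ultimately have "r \<in> {r. 0 < r \<and> inverse r *\<^sub>R v \<in> scaled_hull x \<alpha>}" using e(2) by blast
  then show ?thesis
    unfolding rho_altdef using b by (intro cInf_greatest) auto
qed

text \<open>The infimum in the gauge is attained because the hull is compact. This equivalence replaces the
infimum by membership in a convex set in what follows.\<close>

lemma rho_le_iff:
  assumes pos: "\<And>i. 0 < \<alpha> $ i" and r: "0 < r"
  shows "rho x \<alpha> v \<le> r \<longleftrightarrow> inverse r *\<^sub>R v \<in> scaled_hull x \<alpha>"
proof
  assume le: "rho x \<alpha> v \<le> r"
  have above: "inverse s *\<^sub>R v \<in> scaled_hull x \<alpha>" if s: "r < s" for s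
  proof -
    have "\<not> s \<le> rho x \<alpha> v" using le s by simp
    then obtain q where q: "0 < q" "inverse q *\<^sub>R v \<in> scaled_hull x \<alpha>" "q < s"
      using rho_ge[OF pos, of v s] by force
    then show ?thesis
      using scaleR_in_scaled_hull[OF q(2), of "q / s"] r s by (simp add: field_simps)
  qed
  have lim: "((\<lambda>s. inverse s *\<^sub>R v) \<longlongrightarrow> inverse r *\<^sub>R v) (at_right r)"
    using r by (intro tendsto_intros) auto
  have ev: "\<forall>\<^sub>F s in at_right r. inverse s *\<^sub>R v \<in> scaled_hull x \<alpha>"
    using above by (intro eventually_at_rightI[of r "r + 1"]) auto
  show "inverse r *\<^sub>R v \<in> scaled_hull x \<alpha>"
    by (rule Lim_in_closed_set[OF compact_imp_closed[OF compact_scaled_hull] ev trivial_limit_at_right_real lim])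
next
  assume "inverse r *\<^sub>R v \<in> scaled_hull x \<alpha>"
  then show "rho x \<alpha> v \<le> r" using rho_le r by blast
qed

text \<open>The maximality of the gauge: the unit ball of \<open>p\<close> is convex and symmetric and contains the points
spanning the scaled hull, hence the whole hull.\<close>

lemma le_rho:
  assumes pos: "\<And>i. 0 < \<alpha> $ i"
    and add: "\<And>v w. p (v + w) \<le> p v + p w" and scale: "\<And>c v. p (c *\<^sub>R v) = \<bar>c\<bar> * p v"
    and x: "\<And>i. p (x i) \<le> \<alpha> $ i"
  shows "p v \<le> rho x \<alpha> v"
proof (rule rho_ge[OF pos])
  fix r :: real assume r: "0 < r" "inverse r *\<^sub>R v \<in> scaled_hull x \<alpha>"
  have "convex {v. p v \<le> 1}"
  proof (rule convexI)
    fix v w and s t :: real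
    assume vw: "v \<in> {v. p v \<le> 1}" "w \<in> {v. p v \<le> 1}" and st: "0 \<le> s" "0 \<le> t" "s + t = 1"
    have "s * p v \<le> s * 1" "t * p w \<le> t * 1"
      using vw st by (intro mult_left_mono; simp)+
    then show "s *\<^sub>R v + t *\<^sub>R w \<in> {v. p v \<le> 1}"
      using add[of "s *\<^sub>R v" "t *\<^sub>R w"] st by (simp add: scale)
  qed
  moreover have "p (inverse (\<alpha> $ i) *\<^sub>R x i) \<le> 1" for i
    using x[of i] pos[of i] by (simp add: scale field_simps)
  moreover have "p (- v) = p v" for v using scale[of "-1" v] by simp
  ultimately have "scaled_hull x \<alpha> \<subseteq> {v. p v \<le> 1}"
    by (intro scaled_hull_subset) auto
  then show "p v \<le> r" using r by (force simp: scale field_simps)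
qed

lemma rho_nonneg: assumes pos: "\<And>i. 0 < \<alpha> $ i" shows "0 \<le> rho x \<alpha> v"
  by (rule rho_ge[OF pos]) simp_all

text \<open>An instance of \<open>le_rho\<close>, with \<open>m\<close> the least entry of \<open>\<alpha>\<close>; the directions are unit vectors.\<close>

lemma norm_le_rho:
  assumes pos: "\<And>i. 0 < \<alpha> $ i"
  obtains m where "0 < m" "\<And>v. m * norm v \<le> rho x \<alpha> v"
proof -
  define m where "m = Min (range (\<lambda>i. \<alpha> $ i))"
  have m: "0 < m" "\<And>i. m \<le> \<alpha> $ i" using pos unfolding m_def by auto
  have "m * norm v \<le> rho x \<alpha> v" for v
  proof (rule le_rho[OF pos])
    show "m * norm (v + w) \<le> m * norm v + m * norm w" for v w :: 'a
      using m(1) norm_triangle_ineq[of v w]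
      by (metis distrib_left less_imp_le mult_left_mono)
  qed (use m norm_E[OF x_in_E] in simp_all)
  then show thesis using that m(1) by blast
qed

lemma rho_zero: assumes pos: "\<And>i. 0 < \<alpha> $ i" shows "rho x \<alpha> 0 = 0"
proof (rule antisym[OF _ rho_nonneg[OF pos]])
  show "rho x \<alpha> 0 \<le> 0"
    by (rule field_le_epsilon) (simp add: rho_le zero_in_scaled_hull)
qed

lemma rho_pos: assumes pos: "\<And>i. 0 < \<alpha> $ i" and v: "v \<noteq> 0" shows "0 < rho x \<alpha> v"
proof -
  obtain m where m: "0 < m" "\<And>v. m * norm v \<le> rho x \<alpha> v" using norm_le_rho[OF pos] by blast
  have "0 < m * norm v" using m(1) v by simp
  then show ?thesis using m(2)[of v] by linarith
qed

lemma rho_scaleR_pos: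
  assumes pos: "\<And>i. 0 < \<alpha> $ i" and c: "0 < c" shows "rho x \<alpha> (c *\<^sub>R v) \<le> c * rho x \<alpha> v"
proof (cases "v = 0")
  case True
  then show ?thesis by (simp add: rho_zero[OF pos])
next
  case False
  then have r: "0 < rho x \<alpha> v" by (rule rho_pos[OF pos])
  then have "inverse (rho x \<alpha> v) *\<^sub>R v \<in> scaled_hull x \<alpha>"
    using rho_le_iff[OF pos r, of v] by simp
  moreover have "inverse (c * rho x \<alpha> v) *\<^sub>R (c *\<^sub>R v) = inverse (rho x \<alpha> v) *\<^sub>R v"
    using c r by (simp add: field_simps)
  ultimately have "inverse (c * rho x \<alpha> v) *\<^sub>R (c *\<^sub>R v) \<in> scaled_hull x \<alpha>"
    by (simp only:)
  then show ?thesis by (rule rho_le[rotated]) (simp add: c r)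
qed

lemma rho_uminus: "rho x \<alpha> (- v) = rho x \<alpha> v"
proof -
  have "inverse r *\<^sub>R (- v) \<in> scaled_hull x \<alpha> \<longleftrightarrow> inverse r *\<^sub>R v \<in> scaled_hull x \<alpha>" for r
    using uminus_in_scaled_hull[of "inverse r *\<^sub>R v" \<alpha>] uminus_in_scaled_hull[of "- (inverse r *\<^sub>R v)" \<alpha>]
    by auto
  then show ?thesis unfolding rho_altdef by simp
qed

lemma rho_scaleR:
  assumes pos: "\<And>i. 0 < \<alpha> $ i" shows "rho x \<alpha> (c *\<^sub>R v) = \<bar>c\<bar> * rho x \<alpha> v"
proof -
  have p: "rho x \<alpha> (c *\<^sub>R v) = c * rho x \<alpha> v" if c: "0 < c" for c v
  proof (rule antisym[OF rho_scaleR_pos[OF pos c]])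
    have "rho x \<alpha> (inverse c *\<^sub>R c *\<^sub>R v) \<le> inverse c * rho x \<alpha> (c *\<^sub>R v)"
      using c by (intro rho_scaleR_pos[OF pos]) simp
    then show "c * rho x \<alpha> v \<le> rho x \<alpha> (c *\<^sub>R v)" using c by (simp add: field_simps)
  qed
  consider "c > 0" | "c = 0" | "c < 0" by linarith
  then show ?thesis
  proof cases
    case 3
    then show ?thesis using p[of "- c" v] rho_uminus[of \<alpha> "c *\<^sub>R v"] by simp
  qed (simp_all add: p rho_zero[OF pos])
qed

lemma rho_add:
  assumes pos: "\<And>i. 0 < \<alpha> $ i" shows "rho x \<alpha> (v + w) \<le> rho x \<alpha> v + rho x \<alpha> w"
proof (cases "v = 0 \<or> w = 0")
  case True
  then show ?thesis by (auto simp: rho_zero[OF pos])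
next
  case False
  let ?r = "rho x \<alpha> v" and ?s = "rho x \<alpha> w"
  have rs: "0 < ?r" "0 < ?s" using False rho_pos[OF pos] by auto
  have "inverse ?r *\<^sub>R v \<in> scaled_hull x \<alpha>" "inverse ?s *\<^sub>R w \<in> scaled_hull x \<alpha>"
    using rho_le_iff[OF pos rs(1), of v] rho_le_iff[OF pos rs(2), of w] by auto
  then have "(?r / (?r + ?s)) *\<^sub>R (inverse ?r *\<^sub>R v) + (?s / (?r + ?s)) *\<^sub>R (inverse ?s *\<^sub>R w) \<in> scaled_hull x \<alpha>"
    using rs by (intro convexD[OF convex_scaled_hull]) (auto simp: add_divide_distrib[symmetric])
  moreover have "(?r / (?r + ?s)) *\<^sub>R (inverse ?r *\<^sub>R v) = inverse (?r + ?s) *\<^sub>R v"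
    "(?s / (?r + ?s)) *\<^sub>R (inverse ?s *\<^sub>R w) = inverse (?r + ?s) *\<^sub>R w"
    using rs by (simp_all add: field_simps)
  ultimately have "inverse (?r + ?s) *\<^sub>R (v + w) \<in> scaled_hull x \<alpha>"
    by (simp only: scaleR_add_right)
  then show ?thesis using rs by (intro rho_le) simp_all
qed

lemma equivalent_norm_rho:
  assumes pos: "\<And>i. 0 < \<alpha> $ i" shows "equivalent_norm (rho x \<alpha>)"
proof -
  obtain m where m: "0 < m" "\<And>v. m * norm v \<le> rho x \<alpha> v" using norm_le_rho[OF pos] by blast
  obtain e where e: "0 < e" "\<And>v. norm v < e \<Longrightarrow> v \<in> scaled_hull x \<alpha>"
    using absorbing_scaled_hull[of \<alpha>] pos by blast
  have "rho x \<alpha> v \<le> (2 / e) * norm v" for v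
  proof (cases "v = 0")
    case False
    have "norm (inverse ((2 / e) * norm v) *\<^sub>R v) < e" using False e(1) by (simp add: field_simps)
    then show ?thesis using e False by (intro rho_le) auto
  qed (simp add: rho_zero[OF pos])
  then have "\<exists>a>0. \<exists>b>0. \<forall>v. a * norm v \<le> rho x \<alpha> v \<and> rho x \<alpha> v \<le> b * norm v"
    using m e(1) by (intro exI[of _ m] conjI exI[of _ "2 / e"] allI) simp_all
  moreover have "rho x \<alpha> v = 0 \<longleftrightarrow> v = 0" for v
    using rho_pos[OF pos, of v] rho_zero[OF pos] by (cases "v = 0") auto
  ultimately show ?thesis
    unfolding equivalent_norm_def
    by (intro conjI allI rho_nonneg[OF pos] rho_scaleR[OF pos] rho_add[OF pos])
qed

lemma norm_ball_rho:
  assumes pos: "\<And>i. 0 < \<alpha> $ i" shows "norm_ball (rho x \<alpha>) = scaled_hull x \<alpha>"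
  unfolding norm_ball_def using rho_le_iff[OF pos, of 1] by auto

lemma rho_generator_le:
  assumes pos: "\<And>i. 0 < \<alpha> $ i" shows "rho x \<alpha> (x i) \<le> \<alpha> $ i"
  using pos scaled_point_in_hull by (intro rho_le) auto


section \<open>Admissible multiindices\<close>

lemma scaled_hull_mono:
  assumes gen: "\<And>i. inverse (\<beta> $ i) *\<^sub>R x i \<in> scaled_hull x \<alpha>"
  shows "scaled_hull x \<beta> \<subseteq> scaled_hull x \<alpha>"
  using gen uminus_in_scaled_hull by (intro scaled_hull_subset convex_scaled_hull)

text \<open>If \<open>rho x \<alpha> (x i) < \<alpha> $ i\<close>, the entry \<open>\<alpha> $ i\<close> can be replaced by \<open>rho x \<alpha> (x i)\<close>: the
enlarged generator still lies in the hull, so the hull is the same. If equality holds, every smaller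
entry bounds the new gauge at \<open>x i\<close> strictly below the old one.\<close>

lemma admissible_iff:
  assumes pos: "\<And>i. 0 < \<alpha> $ i"
  shows "admissible_multiindex x \<alpha> \<longleftrightarrow> (\<forall>i. rho x \<alpha> (x i) = \<alpha> $ i)"
proof (intro iffI allI)
  fix i assume adm: "admissible_multiindex x \<alpha>"
  show "rho x \<alpha> (x i) = \<alpha> $ i"
  proof (rule ccontr)
    assume "rho x \<alpha> (x i) \<noteq> \<alpha> $ i"
    then have lt: "rho x \<alpha> (x i) < \<alpha> $ i" using rho_generator_le[OF pos, of i] by simp
    have "x i \<noteq> 0" using norm_E[OF x_in_E, of i] by force
    then have r: "0 < rho x \<alpha> (x i)" by (rule rho_pos[OF pos])
    define \<epsilon> where "\<epsilon> = \<alpha> $ i - rho x \<alpha> (x i)"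
    define \<beta> where "\<beta> = (\<chi> j. if j = i then \<alpha> $ j - \<epsilon> else \<alpha> $ j)"
    have \<beta>: "\<beta> $ j = (if j = i then rho x \<alpha> (x i) else \<alpha> $ j)" for j
      unfolding \<beta>_def \<epsilon>_def by simp
    have \<beta>pos: "0 < \<beta> $ j" for j unfolding \<beta> using r pos by simp
    have \<beta>le: "\<beta> $ j \<le> \<alpha> $ j" for j unfolding \<beta> using lt by simp
    have "scaled_hull x \<alpha> \<subseteq> scaled_hull x \<beta>"
    proof (rule scaled_hull_mono)
      fix j
      have "inverse (\<alpha> $ j) *\<^sub>R x j = (\<beta> $ j / \<alpha> $ j) *\<^sub>R (inverse (\<beta> $ j) *\<^sub>R x j)"
        using \<beta>pos[of j] by (simp add: field_simps)
      also have "\<dots> \<in> scaled_hull x \<beta>"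
        using \<beta>pos[of j] \<beta>le[of j] pos[of j]
        by (intro scaleR_in_scaled_hull scaled_point_in_hull) simp_all
      finally show "inverse (\<alpha> $ j) *\<^sub>R x j \<in> scaled_hull x \<beta>" .
    qed
    moreover have "scaled_hull x \<beta> \<subseteq> scaled_hull x \<alpha>"
    proof (rule scaled_hull_mono)
      fix j
      have "inverse (rho x \<alpha> (x i)) *\<^sub>R x i \<in> scaled_hull x \<alpha>"
        using rho_le_iff[OF pos r, of "x i"] by simp
      then show "inverse (\<beta> $ j) *\<^sub>R x j \<in> scaled_hull x \<alpha>"
        unfolding \<beta> using scaled_point_in_hull(1) by simp
    qed
    ultimately have eq: "scaled_hull x \<beta> = scaled_hull x \<alpha>" by simp
    have "rho x \<beta> = rho x \<alpha>" by (rule ext) (simp only: rho_def eq)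
    moreover have "0 < \<epsilon>" "\<epsilon> < \<alpha> $ i" unfolding \<epsilon>_def using lt r by auto
    ultimately show False
      using adm unfolding admissible_multiindex_def \<beta>_def by blast
  qed
next
  assume gen: "\<forall>i. rho x \<alpha> (x i) = \<alpha> $ i"
  show "admissible_multiindex x \<alpha>"
    unfolding admissible_multiindex_def
  proof (intro allI impI)
    fix i \<epsilon> assume \<epsilon>: "0 < \<epsilon> \<and> \<epsilon> < \<alpha> $ i"
    let ?\<beta> = "\<chi> j. if j = i then \<alpha> $ j - \<epsilon> else \<alpha> $ j"
    have "rho x ?\<beta> (x i) \<le> ?\<beta> $ i"
      using pos \<epsilon> by (intro rho_generator_le) simp
    then have "rho x ?\<beta> (x i) < rho x \<alpha> (x i)" using gen \<epsilon> by simp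
    then show "rho x ?\<beta> \<noteq> rho x \<alpha>" by (metis less_irrefl)
  qed
qed

lemma R_dir_iff: "\<alpha> \<in> R_dir x \<longleftrightarrow> (\<forall>i. 0 < \<alpha> $ i) \<and> (\<forall>i. rho x \<alpha> (x i) = \<alpha> $ i)"
  unfolding R_dir_def using admissible_iff[of \<alpha>] by blast

lemma R_dirD: assumes "\<alpha> \<in> R_dir x" shows "0 < \<alpha> $ i" "rho x \<alpha> (x i) = \<alpha> $ i"
  using assms unfolding R_dir_iff by auto

lemma equivalent_norm_x_pos: assumes "equivalent_norm p" shows "0 < p (x i)"
proof -
  have "x i \<noteq> 0" using norm_E[OF x_in_E, of i] by force
  then show ?thesis
    using equivalent_normD(1)[OF assms, of "x i"] equivalent_normD(2)[OF assms, of "x i"] by simp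
qed

lemma norm_le_rho_values:
  assumes p: "equivalent_norm p"
  shows "p v \<le> rho x (\<chi> i. p (x i)) v"
  using equivalent_norm_x_pos[OF p] equivalent_normD[OF p] by (intro le_rho) auto

text \<open>The gauge of the values of a norm always dominates the norm, so being such a gauge is a one-sided
condition. It is verified separately for the two classes of norms.\<close>

lemma values_in_R_dir:
  assumes p: "equivalent_norm p" and le: "\<And>v. rho x (\<chi> i. p (x i)) v \<le> p v"
  shows "rho x (\<chi> i. p (x i)) = p" "(\<chi> i. p (x i)) \<in> R_dir x"
proof -
  show eq: "rho x (\<chi> i. p (x i)) = p"
    using le norm_le_rho_values[OF p] by (intro ext antisym)
  show "(\<chi> i. p (x i)) \<in> R_dir x"
    unfolding R_dir_iff eq using equivalent_norm_x_pos[OF p] by simp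
qed


section \<open>Comparing distances\<close>

lemma rho_le_mult_iff:
  assumes \<alpha>: "\<alpha> \<in> R_dir x" and \<beta>: "\<beta> \<in> R_dir x" and u: "0 < u"
  shows "(\<forall>v. rho x \<beta> v \<le> u * rho x \<alpha> v) \<longleftrightarrow> (\<forall>i. \<beta> $ i \<le> u * \<alpha> $ i)"
proof
  assume "\<forall>v. rho x \<beta> v \<le> u * rho x \<alpha> v"
  then show "\<forall>i. \<beta> $ i \<le> u * \<alpha> $ i"
    using R_dirD(2)[OF \<alpha>] R_dirD(2)[OF \<beta>] by metis
next
  assume le: "\<forall>i. \<beta> $ i \<le> u * \<alpha> $ i"
  show "\<forall>v. rho x \<beta> v \<le> u * rho x \<alpha> v"
  proof
    fix v
    have "rho x \<beta> v / u \<le> rho x \<alpha> v"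
    proof (rule le_rho[OF R_dirD(1)[OF \<alpha>]])
      show "rho x \<beta> (v + w) / u \<le> rho x \<beta> v / u + rho x \<beta> w / u" for v w
        using u rho_add[OF R_dirD(1)[OF \<beta>]]
        by (simp add: add_divide_distrib[symmetric] divide_right_mono)
      show "rho x \<beta> (c *\<^sub>R v) / u = \<bar>c\<bar> * (rho x \<beta> v / u)" for c v
        by (simp add: rho_scaleR[OF R_dirD(1)[OF \<beta>]])
      show "rho x \<beta> (x i) / u \<le> \<alpha> $ i" for i
        using le u by (simp add: R_dirD(2)[OF \<beta>] divide_le_eq mult.commute)
    qed
    then show "rho x \<beta> v \<le> u * rho x \<alpha> v" using u by (simp add: divide_le_eq mult.commute)
  qed
qed

lemma optimal_upper_rho:
  assumes \<alpha>: "\<alpha> \<in> R_dir x" and \<beta>: "\<beta> \<in> R_dir x"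
  shows "optimal_upper (rho x \<alpha>) (rho x \<beta>) = Max (range (\<lambda>i. \<beta> $ i / \<alpha> $ i))"
proof -
  let ?M = "Max (range (\<lambda>i. \<beta> $ i / \<alpha> $ i))"
  have "0 < \<beta> $ undefined / \<alpha> $ undefined" using R_dirD(1)[OF \<alpha>] R_dirD(1)[OF \<beta>] by simp
  also have "\<dots> \<le> ?M" by (intro Max_ge) auto
  finally have M: "0 < ?M" .
  have "0 < u \<and> (\<forall>v. rho x \<beta> v \<le> u * rho x \<alpha> v) \<longleftrightarrow> ?M \<le> u" for u
  proof (cases "0 < u")
    case True
    have "(\<forall>i. \<beta> $ i \<le> u * \<alpha> $ i) \<longleftrightarrow> (\<forall>i. \<beta> $ i / \<alpha> $ i \<le> u)"
      using R_dirD(1)[OF \<alpha>] by (simp add: divide_le_eq)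
    also have "\<dots> \<longleftrightarrow> ?M \<le> u" by (subst Max_le_iff) auto
    finally show ?thesis using True rho_le_mult_iff[OF \<alpha> \<beta> True] by simp
  next
    case False
    then have "\<not> ?M \<le> u" using M by linarith
    then show ?thesis using False by blast
  qed
  then have "{u. 0 < u \<and> (\<forall>v. rho x \<beta> v \<le> u * rho x \<alpha> v)} = {?M..}" by auto
  then show ?thesis unfolding optimal_upper_def by simp
qed

lemma optimal_lower_rho:
  assumes \<alpha>: "\<alpha> \<in> R_dir x" and \<beta>: "\<beta> \<in> R_dir x"
  shows "optimal_lower (rho x \<alpha>) (rho x \<beta>) = Min (range (\<lambda>i. \<beta> $ i / \<alpha> $ i))"
proof -
  let ?m = "Min (range (\<lambda>i. \<beta> $ i / \<alpha> $ i))"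
  have m: "0 < ?m" using R_dirD(1)[OF \<alpha>] R_dirD(1)[OF \<beta>] by (subst Min_gr_iff) auto
  have le_iff: "(\<forall>v. l * rho x \<alpha> v \<le> rho x \<beta> v) \<longleftrightarrow> l \<le> ?m" if l: "0 < l" for l
  proof -
    have "(\<forall>v. l * rho x \<alpha> v \<le> rho x \<beta> v) \<longleftrightarrow> (\<forall>v. rho x \<alpha> v \<le> inverse l * rho x \<beta> v)"
      using l by (simp add: field_simps)
    also have "\<dots> \<longleftrightarrow> (\<forall>i. \<alpha> $ i \<le> inverse l * \<beta> $ i)"
      using l by (intro rho_le_mult_iff[OF \<beta> \<alpha>]) simp
    also have "\<dots> \<longleftrightarrow> (\<forall>i. l \<le> \<beta> $ i / \<alpha> $ i)"
      using l R_dirD(1)[OF \<alpha>] by (simp add: field_simps)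
    also have "\<dots> \<longleftrightarrow> l \<le> ?m" by (subst Min_ge_iff) auto
    finally show ?thesis .
  qed
  have "{l. 0 < l \<and> (\<forall>v. l * rho x \<alpha> v \<le> rho x \<beta> v)} = {0<..?m}"
    by (intro set_eqI, unfold mem_Collect_eq greaterThanAtMost_iff) (use le_iff in blast)
  then show ?thesis unfolding optimal_lower_def using m by simp
qed

end

lemma Max_inverse_range:
  fixes f :: "'n::finite \<Rightarrow> real"
  assumes "\<And>i. 0 < f i"
  shows "Max (range (\<lambda>i. inverse (f i))) = inverse (Min (range f))"
proof (rule Max_eqI)
  have "Min (range f) \<in> range f" by (intro Min_in) auto
  then obtain i where i: "Min (range f) = f i" by blast
  show "inverse (Min (range f)) \<in> range (\<lambda>i. inverse (f i))" unfolding i by (rule rangeI)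
  have "0 < Min (range f)" using assms by (subst Min_gr_iff) auto
  moreover have "Min (range f) \<le> f i" for i by (intro Min_le) auto
  ultimately show "y \<le> inverse (Min (range f))" if "y \<in> range (\<lambda>i. inverse (f i))" for y
    using that by (auto intro: le_imp_inverse_le)
qed simp

text \<open>Taking inverses exchanges the maximum and the minimum.\<close>

lemma hilbert_dist_sym:
  assumes "\<And>i. 0 < \<alpha> $ i" "\<And>i. 0 < \<beta> $ i"
  shows "hilbert_dist \<alpha> \<beta> = hilbert_dist \<beta> \<alpha>"
proof -
  let ?f = "\<lambda>i. \<beta> $ i / \<alpha> $ i" and ?g = "\<lambda>i. \<alpha> $ i / \<beta> $ i"
  have "Max (range ?g) = inverse (Min (range ?f))" "Max (range ?f) = inverse (Min (range ?g))"
    using Max_inverse_range[of ?f] Max_inverse_range[of ?g] assms by (simp_all add: inverse_eq_divide)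
  then show ?thesis
    unfolding hilbert_dist_def by (simp add: divide_inverse mult.commute)
qed

lemma hilbert_dist_scale:
  assumes c: "0 < c"
  shows "hilbert_dist (c *\<^sub>R \<alpha>) \<beta> = hilbert_dist \<alpha> \<beta>"
proof -
  let ?A = "range (\<lambda>i. \<alpha> $ i / \<beta> $ i)"
  have img: "range (\<lambda>i. (c *\<^sub>R \<alpha>) $ i / \<beta> $ i) = (\<lambda>r. c * r) ` ?A" by (auto simp: image_image)
  have "mono (\<lambda>r. c * r)" using c by (intro monoI mult_left_mono) auto
  then have "Max ((\<lambda>r. c * r) ` ?A) = c * Max ?A" "Min ((\<lambda>r. c * r) ` ?A) = c * Min ?A"
    using mono_Max_commute[of "\<lambda>r. c * r" ?A] mono_Min_commute[of "\<lambda>r. c * r" ?A] by auto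
  then show ?thesis unfolding hilbert_dist_def img using c by simp
qed

context direction_family
begin

lemma norm_dist_rho:
  assumes \<alpha>: "\<alpha> \<in> R_dir x" and \<beta>: "\<beta> \<in> R_dir x"
  shows "norm_dist (rho x \<alpha>) (rho x \<beta>) = hilbert_dist \<alpha> \<beta>"
proof -
  have "norm_dist (rho x \<alpha>) (rho x \<beta>) = hilbert_dist \<beta> \<alpha>"
    unfolding norm_dist_def hilbert_dist_def optimal_upper_rho[OF \<alpha> \<beta>] optimal_lower_rho[OF \<alpha> \<beta>] ..
  also have "\<dots> = hilbert_dist \<alpha> \<beta>"
    using R_dirD(1)[OF \<alpha>] R_dirD(1)[OF \<beta>] by (intro hilbert_dist_sym)
  finally show ?thesis .
qed

lemma rho_eq_scale_iff:
  assumes \<alpha>: "\<alpha> \<in> R_dir x" and \<beta>: "\<beta> \<in> R_dir x" and c: "0 < c"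
  shows "rho x \<beta> = scale_fun c (rho x \<alpha>) \<longleftrightarrow> \<beta> = c *\<^sub>R \<alpha>"
proof
  assume eq: "rho x \<beta> = scale_fun c (rho x \<alpha>)"
  have "\<beta> $ i = c * \<alpha> $ i" for i
    using fun_cong[OF eq, of "x i"] R_dirD(2)[OF \<alpha>, of i] R_dirD(2)[OF \<beta>, of i]
    by (simp add: scale_fun_def)
  then show "\<beta> = c *\<^sub>R \<alpha>" by (simp add: vec_eq_iff)
next
  assume eq: "\<beta> = c *\<^sub>R \<alpha>"
  have "rho x \<beta> v = c * rho x \<alpha> v" for v
  proof (rule antisym)
    show "rho x \<beta> v \<le> c * rho x \<alpha> v"
      using rho_le_mult_iff[OF \<alpha> \<beta> c] eq by simp
    have "\<forall>v. rho x \<alpha> v \<le> inverse c * rho x \<beta> v"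
      by (subst rho_le_mult_iff[OF \<beta> \<alpha>]) (use c eq in \<open>simp_all add: field_simps\<close>)
    then have "rho x \<alpha> v \<le> inverse c * rho x \<beta> v" by blast
    then show "c * rho x \<alpha> v \<le> rho x \<beta> v" using c by (simp add: field_simps)
  qed
  then show "rho x \<beta> = scale_fun c (rho x \<alpha>)" unfolding scale_fun_def by blast
qed

end


section \<open>Quotients by positive scaling\<close>

lemma mem_index_class: "\<beta> \<in> index_class R \<alpha> \<longleftrightarrow> \<alpha> \<in> R \<and> \<beta> \<in> R \<and> (\<exists>c>0. \<beta> = c *\<^sub>R \<alpha>)"
  unfolding index_class_def scaling_rel_def by auto

lemma mem_norm_class: "q \<in> norm_class N p \<longleftrightarrow> p \<in> N \<and> q \<in> N \<and> (\<exists>c>0. q = scale_fun c p)"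
  unfolding norm_class_def scaling_rel_def by auto

lemma scale_fun_scale_fun: "scale_fun c (scale_fun d p) = scale_fun (c * d) p"
  unfolding scale_fun_def by (simp add: mult.assoc)

lemma norm_class_subset:
  assumes "q \<in> norm_class N p" shows "norm_class N q \<subseteq> norm_class N p"
proof
  fix r assume "r \<in> norm_class N q"
  then obtain c where c: "0 < c" "r = scale_fun c q" "r \<in> N" unfolding mem_norm_class by blast
  obtain d where d: "0 < d" "q = scale_fun d p" "p \<in> N" using assms unfolding mem_norm_class by blast
  have "r = scale_fun (c * d) p" "0 < c * d" using c d by (simp_all add: scale_fun_scale_fun)
  then show "r \<in> norm_class N p" using c d unfolding mem_norm_class by blast
qed

lemma norm_class_eq:
  assumes "q \<in> norm_class N p" shows "norm_class N q = norm_class N p"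
proof (rule antisym)
  obtain d where d: "0 < d" "q = scale_fun d p" "p \<in> N" "q \<in> N"
    using assms unfolding mem_norm_class by blast
  have "p = scale_fun (inverse d) q"
    unfolding d(2) using d(1) by (intro ext) (simp add: scale_fun_def)
  moreover have "0 < inverse d" using d(1) by simp
  ultimately have "p \<in> norm_class N q" using d unfolding mem_norm_class by blast
  then show "norm_class N p \<subseteq> norm_class N q" by (rule norm_class_subset)
qed (rule norm_class_subset[OF assms])

lemma norm_class_self: assumes "p \<in> N" shows "p \<in> norm_class N p"
  unfolding mem_norm_class using assms by (intro conjI exI[of _ 1]) (simp_all add: scale_fun_def)

lemma index_class_self: assumes "\<alpha> \<in> R" shows "\<alpha> \<in> index_class R \<alpha>"
  unfolding mem_index_class using assms by (intro conjI exI[of _ 1]) simp_all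

lemma index_class_eq:
  assumes "\<beta> \<in> index_class R \<alpha>"
  shows "index_class R \<beta> = index_class R \<alpha>"
proof -
  obtain c where c: "0 < c" "\<beta> = c *\<^sub>R \<alpha>" and \<alpha>: "\<alpha> \<in> R" and \<beta>: "\<beta> \<in> R"
    using assms unfolding mem_index_class by blast
  have "(\<exists>d>0. \<gamma> = d *\<^sub>R \<beta>) \<longleftrightarrow> (\<exists>d>0. \<gamma> = d *\<^sub>R \<alpha>)" for \<gamma>
  proof
    assume "\<exists>d>0. \<gamma> = d *\<^sub>R \<beta>"
    then obtain d where "0 < d" "\<gamma> = d *\<^sub>R \<beta>" by blast
    then show "\<exists>d>0. \<gamma> = d *\<^sub>R \<alpha>" using c by (intro exI[of _ "d * c"]) simp
  next
    assume "\<exists>d>0. \<gamma> = d *\<^sub>R \<alpha>"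
    then obtain d where "0 < d" "\<gamma> = d *\<^sub>R \<alpha>" by blast
    then show "\<exists>d>0. \<gamma> = d *\<^sub>R \<beta>" using c by (intro exI[of _ "d / c"]) simp
  qed
  then show ?thesis using \<alpha> \<beta> by (intro set_eqI) (simp add: mem_index_class)
qed

lemma index_quotient_eq: "index_quotient R = index_class R ` R"
  unfolding index_quotient_def index_class_def quotient_def by blast

lemma norm_quotient_eq: "norm_quotient N = norm_class N ` N"
  unfolding norm_quotient_def norm_class_def quotient_def by blast

text \<open>The definite description needs both classes to be nonempty for the value to be unique.\<close>

lemma class_dist_eqI:
  assumes "a \<in> A" "b \<in> B" "\<And>a b. a \<in> A \<Longrightarrow> b \<in> B \<Longrightarrow> d a b = r"
  shows "class_dist d A B = r"
  unfolding class_dist_def using assms by (intro the_equality) auto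

context direction_family
begin

text \<open>For sets of admissible multiindices, evaluation at the directions determines a gauge up to scaling
and \<open>norm_dist_rho\<close> compares distances; only the image of the gauge map has to be found.\<close>

lemma phi_isometryI:
  assumes sub: "R \<subseteq> R_dir x" and into: "\<And>\<alpha>. \<alpha> \<in> R \<Longrightarrow> rho x \<alpha> \<in> N"
    and onto: "\<And>p. p \<in> N \<Longrightarrow> \<exists>\<alpha>\<in>R. rho x \<alpha> = p"
  shows "phi_isometry x R N"
proof -
  have dir: "\<alpha> \<in> R_dir x" if "\<alpha> \<in> R" for \<alpha> using sub that by blast
  have class_iff: "rho x \<beta> \<in> norm_class N (rho x \<alpha>) \<longleftrightarrow> \<beta> \<in> index_class R \<alpha>"
    if "\<alpha> \<in> R" "\<beta> \<in> R" for \<alpha> \<beta>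
    unfolding mem_norm_class mem_index_class
    using that into rho_eq_scale_iff[OF dir dir, of \<alpha> \<beta>] by auto
  have phi: "phi' x N (index_class R \<alpha>) = norm_class N (rho x \<alpha>)" if \<alpha>: "\<alpha> \<in> R" for \<alpha>
    unfolding phi'_def
  proof (rule the_equality)
    have "norm_class N (rho x \<beta>) = norm_class N (rho x \<alpha>)" if "\<beta> \<in> index_class R \<alpha>" for \<beta>
      using that class_iff[OF \<alpha>, of \<beta>] by (intro norm_class_eq) (simp add: mem_index_class)
    then show "\<forall>\<beta>\<in>index_class R \<alpha>. norm_class N (rho x \<alpha>) = norm_class N (rho x \<beta>)" by simp
  qed (use index_class_self[OF \<alpha>] in blast)
  have hilbert: "class_dist hilbert_dist (index_class R \<alpha>) (index_class R \<beta>) = hilbert_dist \<alpha> \<beta>"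
    if \<alpha>: "\<alpha> \<in> R" and \<beta>: "\<beta> \<in> R" for \<alpha> \<beta>
  proof (rule class_dist_eqI[OF index_class_self[OF \<alpha>] index_class_self[OF \<beta>]])
    fix \<gamma> \<delta> assume \<gamma>: "\<gamma> \<in> index_class R \<alpha>" and \<delta>: "\<delta> \<in> index_class R \<beta>"
    obtain c where c: "0 < c" "\<gamma> = c *\<^sub>R \<alpha>" using \<gamma> unfolding mem_index_class by blast
    obtain d where d: "0 < d" "\<delta> = d *\<^sub>R \<beta>" "\<delta> \<in> R" using \<delta> unfolding mem_index_class by blast
    have pos: "0 < \<alpha> $ i" "0 < \<beta> $ i" "0 < \<delta> $ i" for i
      using R_dirD(1) dir \<alpha> \<beta> d(3) by blast+
    have "hilbert_dist \<gamma> \<delta> = hilbert_dist \<alpha> \<delta>" unfolding c(2) by (rule hilbert_dist_scale[OF c(1)])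
    also have "\<dots> = hilbert_dist \<delta> \<alpha>" by (rule hilbert_dist_sym[OF pos(1,3)])
    also have "\<dots> = hilbert_dist \<beta> \<alpha>" unfolding d(2) by (rule hilbert_dist_scale[OF d(1)])
    also have "\<dots> = hilbert_dist \<alpha> \<beta>" by (rule hilbert_dist_sym[OF pos(2,1)])
    finally show "hilbert_dist \<gamma> \<delta> = hilbert_dist \<alpha> \<beta>" .
  qed
  have norm: "class_dist norm_dist (norm_class N (rho x \<alpha>)) (norm_class N (rho x \<beta>)) = hilbert_dist \<alpha> \<beta>"
    if \<alpha>: "\<alpha> \<in> R" and \<beta>: "\<beta> \<in> R" for \<alpha> \<beta>
  proof (rule class_dist_eqI[OF norm_class_self[OF into[OF \<alpha>]] norm_class_self[OF into[OF \<beta>]]])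
    fix p q assume p: "p \<in> norm_class N (rho x \<alpha>)" and q: "q \<in> norm_class N (rho x \<beta>)"
    obtain \<gamma> where \<gamma>: "\<gamma> \<in> R" "rho x \<gamma> = p" using onto p unfolding mem_norm_class by blast
    obtain \<delta> where \<delta>: "\<delta> \<in> R" "rho x \<delta> = q" using onto q unfolding mem_norm_class by blast
    have "index_class R \<gamma> = index_class R \<alpha>"
      using class_iff[OF \<alpha> \<gamma>(1)] \<gamma>(2) p by (intro index_class_eq) simp
    moreover have "index_class R \<delta> = index_class R \<beta>"
      using class_iff[OF \<beta> \<delta>(1)] \<delta>(2) q by (intro index_class_eq) simp
    moreover have "norm_dist p q = hilbert_dist \<gamma> \<delta>"
      using norm_dist_rho[OF dir dir, of \<gamma> \<delta>] \<gamma> \<delta> by simp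
    ultimately show "norm_dist p q = hilbert_dist \<alpha> \<beta>"
      using hilbert[OF \<gamma>(1) \<delta>(1)] hilbert[OF \<alpha> \<beta>] by simp
  qed
  have "bij_betw (phi' x N) (index_quotient R) (norm_quotient N)"
    unfolding bij_betw_def
  proof
    show "inj_on (phi' x N) (index_quotient R)"
    proof (rule inj_onI)
      fix K L assume K: "K \<in> index_quotient R" and L: "L \<in> index_quotient R" and eq: "phi' x N K = phi' x N L"
      obtain \<alpha> where \<alpha>: "\<alpha> \<in> R" "K = index_class R \<alpha>" using K unfolding index_quotient_eq by blast
      obtain \<beta> where \<beta>: "\<beta> \<in> R" "L = index_class R \<beta>" using L unfolding index_quotient_eq by blast
      have "rho x \<beta> \<in> norm_class N (rho x \<alpha>)"
        using eq phi \<alpha> \<beta> norm_class_self[OF into[OF \<beta>(1)]] by simp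
      then have "\<beta> \<in> index_class R \<alpha>" using class_iff \<alpha> \<beta> by blast
      then show "K = L" using \<alpha>(2) \<beta>(2) index_class_eq[of \<beta> R \<alpha>] by simp
    qed
    have "norm_class N ` N = norm_class N ` rho x ` R"
      using into onto by (intro arg_cong[of _ _ "image (norm_class N)"]) blast
    then show "phi' x N ` index_quotient R = norm_quotient N"
      unfolding index_quotient_eq norm_quotient_eq image_image using phi by (simp cong: image_cong)
  qed
  moreover have "class_dist norm_dist (phi' x N K) (phi' x N L) = class_dist hilbert_dist K L"
    if "K \<in> index_quotient R" "L \<in> index_quotient R" for K L
    using that phi hilbert norm unfolding index_quotient_eq by auto
  ultimately show ?thesis
    unfolding phi_isometry_def isometry_onto_def using into phi by simp
qed


section \<open>Norms with prescribed directions of extreme points\<close>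

text \<open>A right inverse of the surjection \<open>u \<mapsto> (\<Sum>i\<in>UNIV. u $ i *\<^sub>R x i)\<close>.\<close>

lemma exists_linear_embedding: "\<exists>J :: 'a \<Rightarrow> real ^ 'n. linear J \<and> inj J"
proof -
  define T :: "real ^ 'n \<Rightarrow> 'a" where "T u = (\<Sum>i\<in>UNIV. u $ i *\<^sub>R x i)" for u
  have T: "linear T"
    unfolding T_def by (intro linearI) (simp_all add: scaleR_add_left sum.distrib scaleR_sum_right)
  have axis: "T (axis i 1) = x i" for i
  proof -
    have "T (axis i 1) = (\<Sum>j\<in>UNIV. if j = i then x j else 0)"
      unfolding T_def by (intro sum.cong) (auto simp: axis_def)
    then show ?thesis by simp
  qed
  have sub: "subspace (range T)" using T by (intro linear_subspace_image) auto
  have x_range: "x i \<in> range T" for i using axis[of i] by (metis rangeI)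
  have "E \<subseteq> range T"
    using x_range subspace_neg[OF sub] by (auto elim!: E_cases)
  then have "surj T" using span_minimal[OF _ sub] span_E by blast
  then obtain J where J: "linear J" "T \<circ> J = id"
    using linear_surjective_right_inverse[OF T] by blast
  have "inj J" using J(2) by (metis inj_on_id inj_on_imageI2)
  then show ?thesis using J(1) by blast
qed

text \<open>The theorem of Krein--Milman and Minkowski holds in \<open>real ^ 'n\<close>, and a
linear embedding preserves compactness, convex hulls and extreme points.\<close>

lemma convex_hull_extreme_points:
  fixes K :: "'a set"
  assumes K: "compact K" "convex K"
  shows "K = convex hull {v. v extreme_point_of K}"
proof -
  obtain J :: "'a \<Rightarrow> real ^ 'n" where J: "linear J" "inj J" using exists_linear_embedding by blast
  have "continuous_on K J"
    using linear_imp_bounded_linear[OF J(1)] by (rule linear_continuous_on)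
  then have "compact (J ` K)" using K(1) by (rule compact_continuous_image)
  then have KM: "J ` K = convex hull {u. u extreme_point_of J ` K}"
    by (rule Krein_Milman_Minkowski[OF _ convex_linear_image[OF J(1) K(2)]])
  have ext_iff: "J v extreme_point_of J ` K \<longleftrightarrow> v extreme_point_of K" for v
    using face_of_linear_image[OF J, of "{v}" K] by (simp add: face_of_singleton)
  have "{u. u extreme_point_of J ` K} = J ` {v. v extreme_point_of K}"
  proof (intro equalityI subsetI)
    fix u assume u: "u \<in> {u. u extreme_point_of J ` K}"
    then obtain v where "u = J v" unfolding extreme_point_of_def by blast
    then show "u \<in> J ` {v. v extreme_point_of K}" using u ext_iff by blast
  qed (use ext_iff in blast)
  then have "J ` K = J ` (convex hull {v. v extreme_point_of K})"
    using KM convex_hull_linear_image[OF J(1)] by metis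
  then show ?thesis using J(2) by (simp add: inj_image_eq_iff)
qed

text \<open>The ball is closed since \<open>p\<close> is Lipschitz, and it is contained in a dilate of the compact scaled
hull for the constant multiindex 1.\<close>

lemma compact_norm_ball:
  fixes p :: "'a \<Rightarrow> real"
  assumes p: "equivalent_norm p"
  shows "compact (norm_ball p)"
proof -
  obtain a b where ab: "0 < a" "0 < b" "\<And>v. a * norm v \<le> p v" "\<And>v. p v \<le> b * norm v"
    using p unfolding equivalent_norm_def by blast
  obtain e where e: "0 < e" "\<And>v. norm v < e \<Longrightarrow> v \<in> scaled_hull x 1"
    using absorbing_scaled_hull[of 1] by auto
  have "b-lipschitz_on UNIV p"
  proof (rule lipschitz_onI)
    fix v w :: 'a
    have "p v \<le> p (v - w) + p w" "p w \<le> p (w - v) + p v"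
      using equivalent_normD(4)[OF p, of "v - w" w] equivalent_normD(4)[OF p, of "w - v" v] by simp_all
    moreover have "p (v - w) \<le> b * norm (v - w)" "p (w - v) \<le> b * norm (v - w)"
      using ab(4)[of "v - w"] ab(4)[of "w - v"] by (simp_all add: norm_minus_commute)
    ultimately show "dist (p v) (p w) \<le> b * dist v w" by (simp add: dist_norm abs_le_iff)
  qed (use ab in simp)
  then have "continuous_on UNIV p" by (rule lipschitz_on_continuous_on)
  then have closed: "closed (norm_ball p)"
    unfolding norm_ball_def by (intro closed_Collect_le continuous_on_const)
  define r where "r = 2 / (a * e)"
  have r: "0 < r" unfolding r_def using ab e by simp
  have "norm_ball p \<subseteq> (\<lambda>w. r *\<^sub>R w) ` scaled_hull x 1"
  proof
    fix v assume "v \<in> norm_ball p"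
    then have "a * norm v \<le> 1" using ab(3)[of v] unfolding norm_ball_def by simp
    then have "a * (e * norm v) \<le> e" using e(1) mult_left_mono[of "a * norm v" 1 e] by (simp add: ac_simps)
    then have "norm (inverse r *\<^sub>R v) < e" 
      using e(1) ab(1) unfolding r_def by (simp add: field_simps)
    then show "v \<in> (\<lambda>w. r *\<^sub>R w) ` scaled_hull x 1" using e(2) mem_scaleR_image_iff[OF r] by blast
  qed
  moreover have "compact ((\<lambda>w. r *\<^sub>R w) ` scaled_hull x 1)"
    by (intro compact_scaling compact_scaled_hull)
  ultimately show ?thesis using closed by (metis Int_absorb1 compact_Int_closed)
qed

lemma rho_in_N_dir:
  assumes pos: "\<And>i. 0 < \<alpha> $ i"
  shows "rho x \<alpha> \<in> N_dir E"
proof -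
  have "v \<in> directions E" if "v extreme_point_of norm_ball (rho x \<alpha>)" for v
  proof -
    have "v \<in> range (\<lambda>i. inverse (\<alpha> $ i) *\<^sub>R x i) \<union> range (\<lambda>i. - (inverse (\<alpha> $ i) *\<^sub>R x i))"
      using that unfolding norm_ball_rho[OF pos] scaled_hull_def by (rule extreme_point_of_convex_hull)
    then obtain i where "v = inverse (\<alpha> $ i) *\<^sub>R x i \<or> v = inverse (\<alpha> $ i) *\<^sub>R (- x i)" by auto
    moreover have "x i \<in> E" "- x i \<in> E" unfolding E_eq by auto
    moreover have "0 < inverse (\<alpha> $ i)" using pos by simp
    ultimately show ?thesis unfolding directions_def by blast
  qed
  then show ?thesis unfolding N_dir_def using equivalent_norm_rho[OF pos] by blast
qed

lemma symmetric_weight_norm: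
  assumes p: "equivalent_norm p" shows "symmetric_weight E p"
  unfolding symmetric_weight_def
proof (intro ballI conjI)
  fix y assume "y \<in> E"
  then have "y \<noteq> 0" using norm_E by force
  then show "0 < p y" using equivalent_normD(1,2)[OF p, of y] by simp
  show "p (- y) = p y" using equivalent_normD(3)[OF p, of "-1" y] by simp
qed

lemma symmetric_weight_pos:
  assumes "symmetric_weight E w" shows "0 < (\<chi> i. w (x i)) $ i"
  using assms x_in_E unfolding symmetric_weight_def by simp

lemma rho_weight_le:
  assumes w: "symmetric_weight E w" and y: "y \<in> E"
  shows "rho x (\<chi> i. w (x i)) y \<le> w y"
  using y
proof (cases rule: E_cases)
  case (1 i)
  then show ?thesis using rho_generator_le[OF symmetric_weight_pos[OF w], of i] by simp
next
  case (2 i)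
  then show ?thesis
    using rho_generator_le[OF symmetric_weight_pos[OF w], of i] w x_in_E[of i]
    unfolding symmetric_weight_def by (simp add: rho_uminus)
qed

lemma scaled_direction_in_hull:
  assumes w: "symmetric_weight E w" and y: "y \<in> E"
  shows "inverse (w y) *\<^sub>R y \<in> scaled_hull x (\<chi> i. w (x i))"
proof -
  have "0 < w y" using w y unfolding symmetric_weight_def by blast
  then show ?thesis
    using rho_le_iff[OF symmetric_weight_pos[OF w], of "w y" y] rho_weight_le[OF w y] by blast
qed

text \<open>An extreme point \<open>c *\<^sub>R y\<close> of the ball with \<open>y \<in> E\<close> satisfies \<open>c * p y \<le> 1\<close>, so it is at most
\<open>y / p y\<close> along its ray and lies in the scaled hull. By Krein--Milman so does the ball.\<close>

lemma rho_le_of_N_dir: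
  assumes "p \<in> N_dir E"
  shows "rho x (\<chi> i. p (x i)) v \<le> p v"
proof -
  let ?\<alpha> = "\<chi> i. p (x i)"
  have p: "equivalent_norm p" and ext: "{v. v extreme_point_of norm_ball p} \<subseteq> directions E"
    using assms unfolding N_dir_def by auto
  have w: "symmetric_weight E p" by (rule symmetric_weight_norm[OF p])
  have "{v. v extreme_point_of norm_ball p} \<subseteq> scaled_hull x ?\<alpha>"
  proof
    fix v assume v: "v \<in> {v. v extreme_point_of norm_ball p}"
    then obtain c y where c: "0 < c" "y \<in> E" "v = c *\<^sub>R y"
      using ext unfolding directions_def by blast
    have "p v \<le> 1" using v unfolding extreme_point_of_def norm_ball_def by simp
    then have "c * p y \<le> 1" using c(1,3) equivalent_normD(3)[OF p, of c y] by simp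
    moreover have "0 < p y" using w c(2) unfolding symmetric_weight_def by blast
    moreover have "v = (c * p y) *\<^sub>R (inverse (p y) *\<^sub>R y)" using c(3) \<open>0 < p y\<close> by simp
    ultimately show "v \<in> scaled_hull x ?\<alpha>"
      using scaleR_in_scaled_hull[OF scaled_direction_in_hull[OF w c(2)], of "c * p y"] c(1) by simp
  qed
  then have "convex hull {v. v extreme_point_of norm_ball p} \<subseteq> scaled_hull x ?\<alpha>"
    by (intro hull_minimal convex_scaled_hull)
  then have ball: "norm_ball p \<subseteq> scaled_hull x ?\<alpha>"
    using convex_hull_extreme_points[OF compact_norm_ball[OF p] convex_norm_ball[OF p]] by simp
  show ?thesis
  proof (cases "v = 0")
    case True
    then show ?thesis using rho_zero[OF symmetric_weight_pos[OF w]] equivalent_normD(1)[OF p, of v] by simp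
  next
    case False
    then have pv: "0 < p v" using equivalent_normD(1,2)[OF p, of v] by simp
    have "inverse (p v) *\<^sub>R v \<in> norm_ball p"
      using pv equivalent_normD(3)[OF p, of "inverse (p v)" v] unfolding norm_ball_def by simp
    then show ?thesis using pv ball by (intro rho_le) auto
  qed
qed

lemma phi_isometry_dir: "phi_isometry x (R_dir x) (N_dir E)"
proof (rule phi_isometryI)
  show "rho x \<alpha> \<in> N_dir E" if "\<alpha> \<in> R_dir x" for \<alpha>
    using R_dirD(1)[OF that] by (rule rho_in_N_dir)
  show "\<exists>\<alpha>\<in>R_dir x. rho x \<alpha> = p" if "p \<in> N_dir E" for p
    using values_in_R_dir[OF _ rho_le_of_N_dir[OF that]] that unfolding N_dir_def by blast
qed simp


section \<open>Norms linear on a fan\<close>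

lemma rho_sum_le:
  assumes pos: "\<And>i. 0 < \<alpha> $ i" and fin: "finite S"
  shows "rho x \<alpha> (\<Sum>s\<in>S. f s) \<le> (\<Sum>s\<in>S. rho x \<alpha> (f s))"
  using fin
proof (induction S rule: finite_induct)
  case empty
  then show ?case by (simp add: rho_zero[OF pos])
next
  case (insert s S)
  then show ?case using rho_add[OF pos, of "f s" "sum f S"] by simp
qed

text \<open>Subadditivity of the gauge, applied to an expansion of \<open>v\<close> in the generators of the cone.\<close>

lemma rho_le_linear_on_cone:
  assumes w: "symmetric_weight E w" and S: "S \<subseteq> E" and l: "linear l" "\<And>s. s \<in> S \<Longrightarrow> l s = w s"
    and v: "v \<in> convex_cone hull S"
  shows "rho x (\<chi> i. w (x i)) v \<le> l v"
proof -
  let ?\<rho> = "rho x (\<chi> i. w (x i))"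
  note pos = symmetric_weight_pos[OF w]
  have fin: "finite S" using S finite_E finite_subset by blast
  obtain c where c: "\<And>s. s \<in> S \<Longrightarrow> 0 \<le> c s" "v = (\<Sum>s\<in>S. c s *\<^sub>R s)"
    using v unfolding convex_cone_hull_finite[OF fin] by blast
  have "?\<rho> v \<le> (\<Sum>s\<in>S. ?\<rho> (c s *\<^sub>R s))" unfolding c(2) by (rule rho_sum_le[OF pos fin])
  also have "\<dots> \<le> (\<Sum>s\<in>S. c s * w s)"
  proof (rule sum_mono)
    fix s assume s: "s \<in> S"
    have "c s * ?\<rho> s \<le> c s * w s"
      using c(1)[OF s] rho_weight_le[OF w] S s by (intro mult_left_mono) auto
    then show "?\<rho> (c s *\<^sub>R s) \<le> c s * w s" using c(1)[OF s] by (simp add: rho_scaleR[OF pos])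
  qed
  also have "\<dots> = l v" unfolding c(2) by (simp add: linear_sum[OF l(1)] linear_scale[OF l(1)] l(2))
  finally show ?thesis .
qed

text \<open>Admissibility says \<open>l \<le> w\<close> on \<open>E\<close>. By the symmetry of \<open>E\<close> and of \<open>w\<close> the seminorm
\<open>\<bar>l v\<bar>\<close> is then one of those that the gauge dominates; the reverse inequality on the cone is
\<open>rho_le_linear_on_cone\<close>.\<close>

lemma rho_linear_on_maximal_cone:
  assumes w: "symmetric_weight E w" and adm: "admissible_fan_weight E F w"
    and S: "S \<subseteq> E" "independent S" "card S = dim (UNIV :: 'a set)"
    and max: "maximal_cone F (convex_cone hull S)"
  obtains l where "bounded_linear l" "\<And>s. s \<in> S \<Longrightarrow> l s = w s"
    "\<And>v. v \<in> convex_cone hull S \<Longrightarrow> rho x (\<chi> i. w (x i)) v = l v"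
proof -
  obtain l where l: "linear l" "\<And>s. s \<in> S \<Longrightarrow> l s = w s"
    using linear_independent_extend[OF S(2), of w] by blast
  have bl: "bounded_linear l" by (rule linear_imp_bounded_linear[OF l(1)])
  have le: "l y \<le> w y" if "y \<in> E" for y
    using adm S max bl l(2) that unfolding admissible_fan_weight_def by blast
  have abs_le: "\<bar>l (x i)\<bar> \<le> (\<chi> i. w (x i)) $ i" for i
  proof -
    have "- x i \<in> E" unfolding E_eq by blast
    then have "l (- x i) \<le> w (x i)"
      using le[of "- x i"] w x_in_E[of i] unfolding symmetric_weight_def by simp
    then show ?thesis using le[OF x_in_E, of i] by (simp add: linear_neg[OF l(1)])
  qed
  have "\<bar>l v\<bar> \<le> rho x (\<chi> i. w (x i)) v" for v
    using abs_le by (intro le_rho[OF symmetric_weight_pos[OF w]])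
      (simp_all add: linear_add[OF l(1)] linear_scale[OF l(1)] abs_mult abs_triangle_ineq)
  then have ge: "l v \<le> rho x (\<chi> i. w (x i)) v" for v by (meson abs_ge_self order_trans)
  have "rho x (\<chi> i. w (x i)) v = l v" if "v \<in> convex_cone hull S" for v
    using rho_le_linear_on_cone[OF w S(1) l that] ge[of v] by (rule antisym)
  then show thesis using that bl l(2) by blast
qed

lemma rho_in_N_fan:
  assumes F: "complete_fan F" "simplicial_fan F" "E_fan E F" and \<alpha>: "\<alpha> \<in> R_fan x E F"
  shows "rho x \<alpha> \<in> N_fan F"
proof -
  obtain w where w: "\<alpha> = (\<chi> i. w (x i))" "symmetric_weight E w" "admissible_fan_weight E F w"
    using \<alpha> unfolding R_fan_def by blast
  have "\<exists>l. bounded_linear l \<and> (\<forall>v\<in>C. rho x \<alpha> v = l v)" if C: "C \<in> F" for C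
  proof -
    obtain S where S: "S \<subseteq> E" "independent S" "card S = dim (UNIV :: 'a set)"
      "maximal_cone F (convex_cone hull S)" "C \<subseteq> convex_cone hull S"
      using cone_below_maximal_simplicial_cone[OF F finite_E C] by metis
    obtain l where "bounded_linear l" "\<And>v. v \<in> convex_cone hull S \<Longrightarrow> rho x \<alpha> v = l v"
      using rho_linear_on_maximal_cone[OF w(2,3) S(1-4)] unfolding w(1) by metis
    then show ?thesis using S(5) by blast
  qed
  then show ?thesis
    unfolding N_fan_def using equivalent_norm_rho symmetric_weight_pos[OF w(2)] w(1) by blast
qed

text \<open>For admissibility, let \<open>C\<close> be a full-dimensional cone on which \<open>p\<close> equals the functional \<open>l\<close>, and take a point \<open>M *\<^sub>R z\<close>
so far inside \<open>C\<close> that \<open>M *\<^sub>R z + y\<close> is still in \<open>C\<close>. Comparing \<open>p\<close> and \<open>l\<close> at these two points,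
subadditivity of \<open>p\<close> yields \<open>l y \<le> p y\<close>.\<close>

lemma values_in_R_fan:
  assumes F: "complete_fan F" "E_fan E F" and p: "p \<in> N_fan F"
  shows "(\<chi> i. p (x i)) \<in> R_fan x E F \<inter> R_dir x" "rho x (\<chi> i. p (x i)) = p"
proof -
  have eq: "equivalent_norm p" and lin: "\<And>C. C \<in> F \<Longrightarrow> \<exists>l. bounded_linear l \<and> (\<forall>v\<in>C. p v = l v)"
    using p unfolding N_fan_def by auto
  have w: "symmetric_weight E p" by (rule symmetric_weight_norm[OF eq])
  have le: "rho x (\<chi> i. p (x i)) v \<le> p v" for v
  proof -
    obtain C where C: "C \<in> F" "v \<in> C" using F(1) unfolding complete_fan_def by blast
    obtain S where S: "S \<subseteq> E" "C = convex_cone hull S" using F(2) C(1) unfolding E_fan_def by blast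
    obtain l where l: "bounded_linear l" "\<And>v. v \<in> C \<Longrightarrow> p v = l v" using lin[OF C(1)] by blast
    have "l s = p s" if "s \<in> S" for s using l(2)[of s] S(2) that hull_inc by metis
    then have "rho x (\<chi> i. p (x i)) v \<le> l v"
      using C(2) S(2) by (intro rho_le_linear_on_cone[OF w S(1) bounded_linear.linear[OF l(1)]]) auto
    then show ?thesis using l(2) C(2) by simp
  qed
  have adm: "admissible_fan_weight E F p"
    unfolding admissible_fan_weight_def
  proof (intro allI impI ballI)
    fix C S l y
    assume "maximal_cone F C \<and> S \<subseteq> E \<and> independent S \<and> card S = dim (UNIV :: 'a set) \<and>
        C = convex_cone hull S \<and> bounded_linear l \<and> (\<forall>y\<in>S. l y = p y)"
    then have C: "C \<in> F" "C = convex_cone hull S" and S: "S \<subseteq> E" "independent S" "card S = dim (UNIV :: 'a set)"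
      and l: "bounded_linear l" "\<And>s. s \<in> S \<Longrightarrow> l s = p s" unfolding maximal_cone_def by auto
    have fin: "finite S" using S finite_E finite_subset by blast
    obtain k where k: "bounded_linear k" "\<And>v. v \<in> C \<Longrightarrow> p v = k v" using lin[OF C(1)] by blast
    have "l s = k s" if "s \<in> S" for s using l(2)[OF that] k(2)[of s] C(2) that hull_inc by metis
    then have pl: "p v = l v" if "v \<in> C" for v
      using linear_eq_on_convex_cone_hull[of l k S v] k l(1) C(2) that bounded_linear.linear by metis
    have span: "span S = UNIV"
      by (rule span_eq_UNIV_of_card_eq_dim[OF finite_E span_E S(2,3)])
    (* M bounds the coordinates of y, so all coordinates of M *\<^sub>R z + y are nonnegative. *)
    define z where "z = \<Sum>S"
    define M where "M = 1 + (\<Sum>s\<in>S. \<bar>representation S y s\<bar>)"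
    have M: "0 < M" unfolding M_def by (intro add_pos_nonneg sum_nonneg) auto
    have bound: "\<bar>representation S y s\<bar> \<le> M" if "s \<in> S" for s
      unfolding M_def using member_le_sum[of s S "\<lambda>s. \<bar>representation S y s\<bar>"] fin that by auto
    have zC: "M *\<^sub>R z \<in> C"
    proof -
      have "M *\<^sub>R z = (\<Sum>s\<in>S. M *\<^sub>R s)" unfolding z_def by (simp add: scaleR_sum_right)
      then show ?thesis
        unfolding C(2) convex_cone_hull_finite[OF fin] using M by (auto intro!: exI[of _ "\<lambda>_. M"])
    qed
    have yz: "M *\<^sub>R z + y \<in> C"
    proof -
      have "y = (\<Sum>s\<in>S. representation S y s *\<^sub>R s)"
        using sum_representation_eq[OF S(2), of y S] span fin by auto
      then have "M *\<^sub>R z + y = (\<Sum>s\<in>S. M *\<^sub>R s) + (\<Sum>s\<in>S. representation S y s *\<^sub>R s)"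
        unfolding z_def by (simp add: scaleR_sum_right)
      also have "\<dots> = (\<Sum>s\<in>S. (M + representation S y s) *\<^sub>R s)"
        by (simp add: sum.distrib scaleR_add_left)
      finally have sum_eq: "M *\<^sub>R z + y = (\<Sum>s\<in>S. (M + representation S y s) *\<^sub>R s)" .
      have "0 \<le> M + representation S y s" if "s \<in> S" for s using bound[OF that] by linarith
      then show ?thesis
        unfolding C(2) by (subst sum_eq) (intro convex_cone_sum[OF _ fin] convex_cone_hull_mul
            convex_cone_convex_cone_hull hull_inc)
    qed
    have "l (M *\<^sub>R z) + l y = p (M *\<^sub>R z + y)"
      using pl[OF yz] l(1) by (simp add: linear_add bounded_linear.linear)
    also have "\<dots> \<le> p (M *\<^sub>R z) + p y" by (rule equivalent_normD(4)[OF eq])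
    also have "p (M *\<^sub>R z) = l (M *\<^sub>R z)" by (rule pl[OF zC])
    finally show "l y \<le> p y" by simp
  qed
  have "(\<chi> i. p (x i)) \<in> R_fan x E F" unfolding R_fan_def using w adm by blast
  then show "(\<chi> i. p (x i)) \<in> R_fan x E F \<inter> R_dir x" using values_in_R_dir(2)[OF eq le] by blast
  show "rho x (\<chi> i. p (x i)) = p" by (rule values_in_R_dir(1)[OF eq le])
qed

text \<open>If the ray through \<open>x i\<close> belongs to the fan, it is a face of a maximal cone with a basis of generators
in \<open>E\<close>. A face containing a sum contains the summands, so the ray contains a generator, and this
unit vector can only be \<open>x i\<close>. On generators the gauge attains the weight.\<close>

lemma R_fan_subset_R_dir:
  assumes F: "complete_fan F" "simplicial_fan F" "E_fan E F" and rays: "all_rays E F"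
  shows "R_fan x E F \<subseteq> R_dir x"
proof
  fix \<alpha> assume "\<alpha> \<in> R_fan x E F"
  then obtain w where w: "\<alpha> = (\<chi> i. w (x i))" "symmetric_weight E w" "admissible_fan_weight E F w"
    unfolding R_fan_def by blast
  have "rho x \<alpha> (x i) = \<alpha> $ i" for i
  proof -
    let ?R = "convex_cone hull {x i}"
    have R: "?R \<in> F" using rays x_in_E unfolding all_rays_def by blast
    obtain S where S: "S \<subseteq> E" "independent S" "card S = dim (UNIV :: 'a set)"
      "maximal_cone F (convex_cone hull S)" "?R \<subseteq> convex_cone hull S"
      using cone_below_maximal_simplicial_cone[OF F finite_E R] by metis
    let ?D = "convex_cone hull S"
    have fin: "finite S" using S(1) finite_E finite_subset by blast
    have "?D \<in> F" using S(4) unfolding maximal_cone_def by blast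
    then have "(?R \<inter> ?D) face_of ?D" using F(1) R unfolding complete_fan_def fan_def by blast
    then have face: "?R face_of ?D" using S(5) by (simp add: Int_absorb2)
    have xR: "x i \<in> ?R" by (simp add: hull_inc)
    then have "x i \<in> ?D" using S(5) by blast
    then obtain c where c: "\<And>s. s \<in> S \<Longrightarrow> 0 \<le> c s" "x i = (\<Sum>s\<in>S. c s *\<^sub>R s)"
      unfolding convex_cone_hull_finite[OF fin] by blast
    have "(\<Sum>s\<in>S. c s *\<^sub>R s) \<noteq> 0" using norm_E[OF x_in_E, of i] c(2) by force
    then obtain s where s: "s \<in> S" "c s *\<^sub>R s \<noteq> 0" by (rule sum.not_neutral_contains_not_neutral)
    have inD: "c t *\<^sub>R t \<in> ?D" if "t \<in> S" for t
      using that c(1) by (intro convex_cone_hull_mul hull_inc)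
    have "c s *\<^sub>R s \<in> ?R"
    proof (rule convex_cone_face_summand[OF face convex_cone_convex_cone_hull])
      show "c s *\<^sub>R s \<in> ?D" by (rule inD[OF s(1)])
      show "(\<Sum>t\<in>S - {s}. c t *\<^sub>R t) \<in> ?D"
        using fin inD by (intro convex_cone_sum convex_cone_convex_cone_hull) auto
      show "c s *\<^sub>R s + (\<Sum>t\<in>S - {s}. c t *\<^sub>R t) \<in> ?R"
        using xR c(2) sum.remove[OF fin s(1), of "\<lambda>t. c t *\<^sub>R t"] by simp
    qed (rule convex_cone_convex_cone_hull)
    then obtain k where k: "0 \<le> k" "c s *\<^sub>R s = k *\<^sub>R x i"
      by (auto simp: convex_cone_hull_finite)
    have "c s = k"
      using arg_cong[OF k(2), of norm] norm_E[OF x_in_E, of i] norm_E[of s] s S(1) c(1)[OF s(1)] k(1)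
      by auto
    then have xs: "x i = s" using k(2) s(2) by auto
    obtain l where l: "\<And>s. s \<in> S \<Longrightarrow> l s = w s" "\<And>v. v \<in> ?D \<Longrightarrow> rho x \<alpha> v = l v"
      using rho_linear_on_maximal_cone[OF w(2,3) S(1-4)] unfolding w(1) by metis
    have "rho x \<alpha> (x i) = w (x i)" using l(1)[OF s(1)] l(2)[OF \<open>x i \<in> ?D\<close>] xs by simp
    then show ?thesis unfolding w(1) by simp
  qed
  then show "\<alpha> \<in> R_dir x" unfolding R_dir_iff using symmetric_weight_pos[OF w(2)] w(1) by simp
qed

lemma phi_isometry_fan:
  assumes F: "complete_fan F" "simplicial_fan F" "E_fan E F"
  shows "phi_isometry x (R_fan x E F \<inter> R_dir x) (N_fan F)"
proof (rule phi_isometryI)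
  show "rho x \<alpha> \<in> N_fan F" if "\<alpha> \<in> R_fan x E F \<inter> R_dir x" for \<alpha>
    using that by (intro rho_in_N_fan[OF F]) blast
  show "\<exists>\<alpha>\<in>R_fan x E F \<inter> R_dir x. rho x \<alpha> = p" if "p \<in> N_fan F" for p
    using values_in_R_fan[OF F(1,3) that] by blast
qed simp

end

theorem theorem5p6:
  fixes E :: "'a::banach set" and x :: "'n::finite \<Rightarrow> 'a"
  assumes finite_dim: "\<exists>B::'a set. finite B \<and> span B = UNIV"
    and dirset: "direction_set E"
    and reps: "antipodal_reps E x"
  shows "phi_isometry x (R_dir x) (N_dir E) \<and>
    (\<forall>F. complete_fan F \<and> symmetric_fan F \<and> simplicial_fan F \<and> E_fan E F \<longrightarrow>
       (all_rays E F \<longrightarrow> phi_isometry x (R_fan x E F) (N_fan F)) \<and>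
       phi_isometry x (R_fan x E F \<inter> R_dir x) (N_fan F))"
proof -
  interpret direction_family E x
    using dirset reps by unfold_locales
  show ?thesis
  proof (intro conjI allI impI)
    show "phi_isometry x (R_dir x) (N_dir E)" by (rule phi_isometry_dir)
  next
    fix F assume F: "complete_fan F \<and> symmetric_fan F \<and> simplicial_fan F \<and> E_fan E F"
    then show fan: "phi_isometry x (R_fan x E F \<inter> R_dir x) (N_fan F)"
      by (intro phi_isometry_fan) simp_all
    assume "all_rays E F"
    then have "R_fan x E F \<inter> R_dir x = R_fan x E F"
      using F by (intro Int_absorb2 R_fan_subset_R_dir) simp_all
    then show "phi_isometry x (R_fan x E F) (N_fan F)" using fan by simp
  qed
qed


end
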